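(* For all integers $m\ge5$ and $2\le d\le m-2$ there exists a non-realizable, non-chirotopal weak phased matroid with underlying matroid the uniform matroid $U_d(m)$ of rank $d$ on $m$ elements.
   Context: The phase hyperfield $\mathbb P$ is the set $S^1\cup\{0\}$ ($S^1\subset\mathbb C$ the unit circle) with the multiplication of $\mathbb C$ and the hyperaddition: $x\boxplus0=0\boxplus x=\{x\}$; $x\boxplus(-x)=\{x,-x,0\}$ for $x\in S^1$; and $x\boxplus y=\left\{\frac{\alpha x+\beta y}{\|\alpha x+\beta y\|}:\alpha,\beta\in\mathbb R_{>0}\right\}$ for $x,y\in S^1$, $y\ne-x$. For subsets, $A\boxplus B=\bigcup_{a\in A,b\in B}a\boxplus b$; $\boxplus$ is associative and commutative. A weak Grassmann–Plücker function (weak phirotope) of rank $d$ on $[m]=\{1,\dots,m\}$ with values in $\mathbb P$ is a nonzero alternating function $\varphi:[m]^d\to\mathbb P$ whose support is the set of bases of a matroid (its underlying matroid) and such that $$0\in\boxplus_{k=1}^{d+1}(-1)^k\varphi(x_1,\dots,\hat x_k,\dots,x_{d+1})\,\varphi(x_k,y_1,\dots,y_{d-1})$$ for all subsets $I=\{x_1,\dots,x_{d+1}\}$, $J=\{y_1,\dots,y_{d-1}\}$ of $[m]$ with $|I\setminus J|\le3$. A weak phased matroid $\Phi$ with underlying matroid $M$ is an equivalence class of weak Grassmann–Plücker functions with values in $\mathbb P$ and underlying matroid $M$ under $\varphi\sim a\varphi$, $a\in S^1$. Let $\operatorname{ph}:\mathbb C\to\mathbb P$, $\operatorname{ph}(0)=0$,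 $\operatorname{ph}(z)=z/|z|$ for $z\ne0$. A weak phased matroid $\Phi$ of rank $d$ on $[m]$ is realizable if there is a complex $d\times m$ matrix $A$ with columns $A^1,\dots,A^m$ such that the function $\varphi_A(i_1,\dots,i_d)=\operatorname{ph}(\det(A^{i_1},\dots,A^{i_d}))$ belongs to $\Phi$. It is chirotopal if there is $\chi\in\Phi$ with $\chi([m]^d)\subseteq\{0,1,-1\}$. *)

theory Defs
  imports
    Complex_Main
    "HOL-Library.FuncSet"
    "HOL-Combinatorics.Permutations"
    "Jordan_Normal_Form.Determinant"
begin

section \<open>The phase hyperfield\<close>

definition phases :: "complex set" where
  "phases = {z. norm z = 1} \<union> {0}"

text \<open>The hyperaddition is only meaningful for arguments in \<^const>\<open>phases\<close>.\<close>

definition phase_add :: "complex \<Rightarrow> complex \<Rightarrow> complex set" (infixl "\<boxplus>" 65) where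
  "x \<boxplus> y =
    (if x = 0 then {y}
     else if y = 0 then {x}
     else if y = - x then {x, - x, 0}
     else {(of_real \<alpha> * x + of_real \<beta> * y) / of_real (norm (of_real \<alpha> * x + of_real \<beta> * y)) |
             \<alpha> \<beta> :: real. \<alpha> > 0 \<and> \<beta> > 0})"

definition phase_set_add :: "complex set \<Rightarrow> complex set \<Rightarrow> complex set" where
  "phase_set_add A B = (\<Union>a\<in>A. \<Union>b\<in>B. a \<boxplus> b)"

text \<open>Iterated hypersum, bracketed to the right; the final summand \<open>{0}\<close> is neutral on
  subsets of \<^const>\<open>phases\<close>.\<close>

fun phase_sum :: "complex list \<Rightarrow> complex set" where
  "phase_sum [] = {0}"
| "phase_sum (z # zs) = phase_set_add {z} (phase_sum zs)"

definition ph :: "complex \<Rightarrow> complex" where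
  "ph z = (if z = 0 then 0 else z / of_real (norm z))"

lemma ph_eq_sgn: "ph z = sgn z"
  by (simp add: ph_def sgn_eq)

lemma ph_in_phases: "ph z \<in> phases"
  by (simp add: ph_def phases_def norm_divide)


section \<open>Matroids, given by their bases\<close>

definition matroid_bases :: "'a set \<Rightarrow> 'a set set \<Rightarrow> bool" where
  "matroid_bases E \<B> \<longleftrightarrow>
     finite E \<and> \<B> \<noteq> {} \<and> (\<forall>B\<in>\<B>. B \<subseteq> E) \<and>
     (\<forall>B\<in>\<B>. \<forall>C\<in>\<B>. \<forall>x\<in>B - C. \<exists>y\<in>C - B. insert y (B - {x}) \<in> \<B>)"

definition uniform_bases :: "nat \<Rightarrow> nat \<Rightarrow> nat set set" where
  "uniform_bases d m = {B. B \<subseteq> {1..m} \<and> card B = d}"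


section \<open>Weak phased matroids\<close>

text \<open>Functions on \<open>[m]\<^sup>d\<close> are functions on lists of length \<open>d\<close>, taken
  extensional (\<^const>\<open>undefined\<close> outside the domain) so that equality is equality on \<open>[m]\<^sup>d\<close>.\<close>

definition tuples :: "nat \<Rightarrow> nat \<Rightarrow> nat list set" where
  "tuples d m = {xs. length xs = d \<and> set xs \<subseteq> {1..m}}"

definition alternating_on :: "nat \<Rightarrow> nat \<Rightarrow> (nat list \<Rightarrow> complex) \<Rightarrow> bool" where
  "alternating_on d m \<phi> \<longleftrightarrow>
     (\<forall>xs\<in>tuples d m. \<forall>p. p permutes {..<d} \<longrightarrow> \<phi> (permute_list p xs) = of_int (sign p) * \<phi> xs) \<and>
     (\<forall>xs\<in>tuples d m. \<not> distinct xs \<longrightarrow> \<phi> xs = 0)"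

definition support_sets :: "nat \<Rightarrow> nat \<Rightarrow> (nat list \<Rightarrow> complex) \<Rightarrow> nat set set" where
  "support_sets d m \<phi> = {set xs | xs. xs \<in> tuples d m \<and> \<phi> xs \<noteq> 0}"

text \<open>The lists \<open>xs\<close> and \<open>ys\<close> enumerate the subsets \<open>I\<close> and \<open>J\<close>, so they are distinct. The index
  \<open>k\<close> runs through \<open>1, \<dots>, d + 1\<close>, and the \<open>k\<close>-th entry of \<open>xs\<close> is \<open>xs ! (k - 1)\<close>.\<close>

definition weak_GP_relations :: "nat \<Rightarrow> nat \<Rightarrow> (nat list \<Rightarrow> complex) \<Rightarrow> bool" where
  "weak_GP_relations d m \<phi> \<longleftrightarrow>
     (\<forall>xs\<in>tuples (d + 1) m. \<forall>ys\<in>tuples (d - 1) m.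
        distinct xs \<and> distinct ys \<and> card (set xs - set ys) \<le> 3 \<longrightarrow>
        0 \<in> phase_sum (map (\<lambda>k. (-1) ^ k * \<phi> (take (k - 1) xs @ drop k xs) * \<phi> (xs ! (k - 1) # ys))
                           [1..<d + 2]))"

definition weak_GP_functions :: "nat \<Rightarrow> nat \<Rightarrow> (nat list \<Rightarrow> complex) set" where
  "weak_GP_functions d m =
     {\<phi> \<in> tuples d m \<rightarrow>\<^sub>E phases.
        (\<exists>xs\<in>tuples d m. \<phi> xs \<noteq> 0) \<and>
        alternating_on d m \<phi> \<and>
        matroid_bases {1..m} (support_sets d m \<phi>) \<and>
        weak_GP_relations d m \<phi>}"

definition weak_GP_functions_over :: "nat \<Rightarrow> nat \<Rightarrow> nat set set \<Rightarrow> (nat list \<Rightarrow> complex) set" where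
  "weak_GP_functions_over d m \<B> = {\<phi> \<in> weak_GP_functions d m. support_sets d m \<phi> = \<B>}"

definition phase_equiv ::
  "nat \<Rightarrow> nat \<Rightarrow> nat set set \<Rightarrow> ((nat list \<Rightarrow> complex) \<times> (nat list \<Rightarrow> complex)) set" where
  "phase_equiv d m \<B> =
     {(\<phi>, \<psi>). \<phi> \<in> weak_GP_functions_over d m \<B> \<and> \<psi> \<in> weak_GP_functions_over d m \<B> \<and>
              (\<exists>a. norm a = 1 \<and> (\<forall>xs\<in>tuples d m. \<psi> xs = a * \<phi> xs))}"

lemma equiv_phase_equiv: "equiv (weak_GP_functions_over d m \<B>) (phase_equiv d m \<B>)"
proof (rule equivI)
  show "phase_equiv d m \<B> \<subseteq> weak_GP_functions_over d m \<B> \<times> weak_GP_functions_over d m \<B>"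
    by (auto simp: phase_equiv_def)
  show "refl_on (weak_GP_functions_over d m \<B>) (phase_equiv d m \<B>)"
    by (auto simp: refl_on_def phase_equiv_def intro!: exI[of _ 1])
  show "sym (phase_equiv d m \<B>)"
  proof (rule symI)
    fix \<phi> \<psi> assume "(\<phi>, \<psi>) \<in> phase_equiv d m \<B>"
    then obtain a where "\<phi> \<in> weak_GP_functions_over d m \<B>" "\<psi> \<in> weak_GP_functions_over d m \<B>"
      and a: "norm a = 1" "\<forall>xs\<in>tuples d m. \<psi> xs = a * \<phi> xs"
      by (auto simp: phase_equiv_def)
    moreover from a have "a \<noteq> 0" by auto
    with a have "norm (inverse a) = 1 \<and> (\<forall>xs\<in>tuples d m. \<phi> xs = inverse a * \<psi> xs)"
      by (simp add: norm_inverse)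
    ultimately show "(\<psi>, \<phi>) \<in> phase_equiv d m \<B>"
      unfolding phase_equiv_def by blast
  qed
  show "trans (phase_equiv d m \<B>)"
  proof (rule transI)
    fix \<phi> \<psi> \<chi> assume "(\<phi>, \<psi>) \<in> phase_equiv d m \<B>" "(\<psi>, \<chi>) \<in> phase_equiv d m \<B>"
    then obtain a b where "\<phi> \<in> weak_GP_functions_over d m \<B>" "\<chi> \<in> weak_GP_functions_over d m \<B>"
      and ab: "norm a = 1" "\<forall>xs\<in>tuples d m. \<psi> xs = a * \<phi> xs"
              "norm b = 1" "\<forall>xs\<in>tuples d m. \<chi> xs = b * \<psi> xs"
      by (auto simp: phase_equiv_def)
    moreover from ab have "norm (b * a) = 1 \<and> (\<forall>xs\<in>tuples d m. \<chi> xs = b * a * \<phi> xs)"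
      by (simp add: norm_mult)
    ultimately show "(\<phi>, \<chi>) \<in> phase_equiv d m \<B>"
      unfolding phase_equiv_def by blast
  qed
qed

definition weak_phased_matroids :: "nat \<Rightarrow> nat \<Rightarrow> nat set set \<Rightarrow> (nat list \<Rightarrow> complex) set set" where
  "weak_phased_matroids d m \<B> = weak_GP_functions_over d m \<B> // phase_equiv d m \<B>"


section \<open>Realizable and chirotopal weak phased matroids\<close>

text \<open>Columns of a \<open>d \<times> m\<close> matrix are numbered from \<open>0\<close> in the library, so \<open>A\<^sup>i\<close> is
  \<open>col A (i - 1)\<close>.\<close>

definition phirotope_of_mat :: "nat \<Rightarrow> nat \<Rightarrow> complex mat \<Rightarrow> nat list \<Rightarrow> complex" where
  "phirotope_of_mat d m A =
     (\<lambda>xs\<in>tuples d m. ph (det (mat_of_cols d (map (\<lambda>i. col A (i - 1)) xs))))"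

definition realizable :: "nat \<Rightarrow> nat \<Rightarrow> (nat list \<Rightarrow> complex) set \<Rightarrow> bool" where
  "realizable d m \<Phi> \<longleftrightarrow> (\<exists>A\<in>carrier_mat d m. phirotope_of_mat d m A \<in> \<Phi>)"

definition chirotopal :: "nat \<Rightarrow> nat \<Rightarrow> (nat list \<Rightarrow> complex) set \<Rightarrow> bool" where
  "chirotopal d m \<Phi> \<longleftrightarrow> (\<exists>\<chi>\<in>\<Phi>. \<chi> ` tuples d m \<subseteq> {0, 1, -1})"

end

theory Submission
  imports Defs
begin

text \<open>
  Start from the phases of the minors of a Vandermonde matrix whose nodes lie on a parabola, so that
  no four nodes are concyclic and no three-term Grassmann--Pluecker relation has real quotients.
  Each of these relations says that \<open>0\<close> lies in the interior of the convex hull of three phases,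
  which is an open condition. Hence the relations survive when the phase of a single basis \<open>B\<close> is
  rotated by a small \<open>\<omega>\<close>.

  Three complex numbers with sum zero and noncollinear phases are determined by these phases up to a
  positive factor. In a realization of the rotated function, the three-term relations not involving
  \<open>B\<close> therefore force the same cross ratios as in the Vandermonde matrix. On five elements two
  such cross ratios determine a third one that does involve the minor at \<open>B\<close>, and its phase shows
  \<open>\<omega> = 1\<close>. The five elements live in a contraction of rank 2 if \<open>m \<ge> d + 3\<close>, and dually in one of
  rank 3 if \<open>d \<ge> 3\<close>. One nonreal quotient also rules out real representatives.
\<close>

section \<open>Vandermonde products and Grassmann--Pluecker relations for minors\<close>

text \<open>The determinant of the Vandermonde matrix with nodes \<open>t x\<close>, given by its
  product formula on lists, so that the order of the list carries the sign.\<close>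

fun vandermonde :: "(nat \<Rightarrow> 'a::comm_ring_1) \<Rightarrow> nat list \<Rightarrow> 'a" where
  "vandermonde t [] = 1"
| "vandermonde t (x # xs) = (\<Prod>y\<leftarrow>xs. t y - t x) * vandermonde t xs"

lemma vandermonde_move_front:
  "vandermonde t (us @ a # vs) = (-1) ^ length us * vandermonde t (a # us @ vs)"
  by (induction us) (simp_all add: algebra_simps)

lemma vandermonde_swap:
  "vandermonde t (us @ a # ms @ b # vs) = - vandermonde t (us @ b # ms @ a # vs)"
proof -
  \<comment> \<open>Bringing \<open>a\<close> and then \<open>b\<close> to the front costs a sign
    that depends only on lengths, so only the swap of the two front entries counts.\<close>
  have "vandermonde t (us @ a # ms @ b # vs)
      = (-1) ^ (length us + (length us + length ms + 1)) * vandermonde t (b # a # us @ ms @ vs)" for a b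
    using vandermonde_move_front[of t us a "ms @ b # vs"]
      vandermonde_move_front[of t "a # us @ ms" b vs]
    by (simp add: power_add mult.assoc del: vandermonde.simps)
  moreover have "vandermonde t (b # a # us @ ms @ vs) = - vandermonde t (a # b # us @ ms @ vs)"
    by (simp add: algebra_simps)
  ultimately show ?thesis
    by simp
qed

lemma permute_list_transpose:
  assumes "i < j" "j < length xs"
  obtains us ms vs where "xs = us @ xs ! i # ms @ xs ! j # vs"
    "permute_list (transpose i j) xs = us @ xs ! j # ms @ xs ! i # vs"
proof -
  define us ms vs where "us = take i xs" and "ms = take (j - Suc i) (drop (Suc i) xs)"
    and "vs = drop (Suc j) xs"
  have l: "length us = i" "length ms = j - Suc i"
    using assms by (auto simp: us_def ms_def)
  have "drop (Suc i) xs = ms @ drop (j - Suc i) (drop (Suc i) xs)"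
    unfolding ms_def by (rule append_take_drop_id[symmetric])
  also have "drop (j - Suc i) (drop (Suc i) xs) = xs ! j # vs"
    using assms by (simp add: vs_def Cons_nth_drop_Suc)
  finally have xs: "xs = us @ xs ! i # ms @ xs ! j # vs"
    using assms id_take_nth_drop[of i xs] by (simp add: us_def)
  have "permute_list (transpose i j) xs = us @ xs ! j # ms @ xs ! i # vs"
  proof (rule nth_equalityI)
    show "length (permute_list (transpose i j) xs) = length (us @ xs ! j # ms @ xs ! i # vs)"
      using arg_cong[OF xs, of length] by simp
    fix k assume "k < length (permute_list (transpose i j) xs)"
    then have "permute_list (transpose i j) xs ! k = xs ! (transpose i j k)"
      by (simp add: permute_list_def)
    moreover have "(us @ a # ms @ b # vs) ! k
        = (if k = i then a else if k = j then b else (us @ c # ms @ e # vs) ! k)" for a b c e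
      using l assms(1) by (auto simp: nth_append nth_Cons split: nat.split)
    note this[of "xs ! j" "xs ! i" "xs ! i" "xs ! j", folded xs]
    ultimately show "permute_list (transpose i j) xs ! k = (us @ xs ! j # ms @ xs ! i # vs) ! k"
      by (simp add: transpose_def)
  qed
  with xs show thesis
    by (rule that)
qed

lemma vandermonde_permute_list:
  assumes "p permutes {..<length xs}"
  shows "vandermonde t (permute_list p xs) = of_int (sign p) * vandermonde t xs"
proof -
  have transp: "vandermonde t (permute_list (transpose i j) xs) = - vandermonde t xs"
    if "i \<noteq> j" "i < length xs" "j < length xs" for i j and xs :: "nat list"
  proof -
    have "vandermonde t (permute_list (transpose i j) xs) = - vandermonde t xs"
      if "i < j" "j < length xs" for i j
      using that by (metis permute_list_transpose vandermonde_swap)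
    with that show ?thesis
      by (metis linorder_neqE_nat transpose_commute)
  qed
  \<comment> \<open>\<open>ys\<close> must be arbitrary: the induction hypothesis is applied to a
    list that a transposition has already permuted.\<close>
  have "vandermonde t (permute_list p ys) = of_int (sign p) * vandermonde t ys"
    if "length ys = length xs" for ys
    using assms finite_lessThan that
  proof (induction arbitrary: ys rule: permutes_induct)
    case (swap a b p)
    have "sign (transpose a b \<circ> p) = - sign p"
      using swap by (subst sign_compose) (auto simp: sign_swap_id permutation_swap_id
          intro: permutation_permutes[THEN iffD2])
    with swap show ?case
      by (simp add: permute_list_compose transp del: o_apply comp_apply)
  qed (simp add: sign_id)
  then show ?thesis
    by simp
qed

lemma vandermonde_eq_0_iff:
  fixes t :: "nat \<Rightarrow> 'a::idom"
  assumes "inj t"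
  shows "vandermonde t xs = 0 \<longleftrightarrow> \<not> distinct xs"
  by (induction xs) (auto simp: prod_list_zero_iff inj_eq[OF assms])

text \<open>Up to a factor that depends only on \<open>I\<close> and \<open>J\<close>, this is the summand of the
  Grassmann--Pluecker relation for the Vandermonde minors in which \<open>a\<close> moves from \<open>I\<close> to \<open>J\<close>.\<close>

definition gp_quot :: "(nat \<Rightarrow> 'a::field) \<Rightarrow> nat set \<Rightarrow> nat set \<Rightarrow> nat \<Rightarrow> 'a" where
  "gp_quot t I J a = (\<Prod>y\<in>J. t y - t a) / (\<Prod>x\<in>I - {a}. t x - t a)"

text \<open>Taking \<open>a\<close> out of \<open>xs\<close> divides by its differences to the other
  entries, and putting it in front of \<open>ys\<close> multiplies by its differences to those. The
  sign \<open>(-1) ^ k\<close> cancels the one from moving \<open>a\<close> to the front of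
  \<open>xs\<close>.\<close>

lemma vandermonde_gp_term:
  fixes t :: "nat \<Rightarrow> 'a::field"
  assumes "inj t" "distinct xs" "distinct ys" "k < length xs"
  shows "(-1) ^ k * vandermonde t (take k xs @ drop (Suc k) xs) * vandermonde t (xs ! k # ys)
    = vandermonde t xs * vandermonde t ys * gp_quot t (set xs) (set ys) (xs ! k)"
proof -
  define a us vs where "a = xs ! k" and "us = take k xs" and "vs = drop (Suc k) xs"
  have xs: "xs = us @ a # vs" and l: "length us = k"
    using assms by (simp_all add: a_def us_def vs_def id_take_nth_drop)
  have d: "distinct (us @ vs)" "set xs - {a} = set (us @ vs)"
    using assms(2) by (auto simp: xs)
  have "vandermonde t xs = (-1) ^ k * ((\<Prod>x\<in>set xs - {a}. t x - t a) * vandermonde t (us @ vs))"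
    using l d by (simp add: xs vandermonde_move_front prod.distinct_set_conv_list del: map_append prod_list.append set_append distinct_append)
  moreover have "(\<Prod>x\<in>set xs - {a}. t x - t a) \<noteq> 0"
    using injD[OF assms(1)] by auto
  moreover have "vandermonde t (a # ys) = (\<Prod>y\<in>set ys. t y - t a) * vandermonde t ys"
    using assms(3) by (simp add: prod.distinct_set_conv_list)
  ultimately show ?thesis
    by (simp add: gp_quot_def a_def[symmetric] us_def[symmetric] vs_def[symmetric] flip: power_add)
qed

lemma gp_quot_eq_0:
  assumes "finite J" "a \<in> J"
  shows "gp_quot t I J a = 0"
  using assms by (auto simp: gp_quot_def)

text \<open>Elements of \<open>S\<close> contribute the same factor to numerator and denominator.
  Cancelling them amounts to contracting \<open>S\<close>.\<close>

lemma gp_quot_cancel: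
  fixes t :: "nat \<Rightarrow> 'a::field"
  assumes "inj t" "finite S" "a \<notin> S" "finite I" "finite J" "S \<inter> I = {}" "S \<inter> J = {}"
  shows "gp_quot t (S \<union> I) (S \<union> J) a = gp_quot t I J a"
proof -
  have "(\<Prod>s\<in>S. t s - t a) \<noteq> 0"
    using assms injD[OF assms(1)] by auto
  moreover have "S \<union> I - {a} = S \<union> (I - {a})"
    using assms by auto
  moreover have "(\<Prod>x\<in>S \<union> (I - {a}). t x - t a) = (\<Prod>x\<in>S. t x - t a) * (\<Prod>x\<in>I - {a}. t x - t a)"
     "(\<Prod>x\<in>S \<union> J. t x - t a) = (\<Prod>x\<in>S. t x - t a) * (\<Prod>x\<in>J. t x - t a)"
    using assms by (auto intro!: prod.union_disjoint)
  ultimately show ?thesis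
    by (simp add: gp_quot_def)
qed

section \<open>Minors of a matrix and their Grassmann-Pluecker relations\<close>

lemma det_mat_of_cols_permute_list:
  fixes f :: "nat \<Rightarrow> 'a::comm_ring_1 vec"
  assumes p: "p permutes {..<d}" and l: "length xs = d"
  shows "det (mat_of_cols d (map f (permute_list p xs)))
    = of_int (sign p) * det (mat_of_cols d (map f xs))"
proof -
  let ?M = "\<lambda>xs. (mat_of_cols d (map f xs))\<^sup>T"
  have pi: "i < d \<Longrightarrow> p i < d" for i
    using permutes_in_image[OF p] by simp
  have "?M (permute_list p xs) = mat d d (\<lambda>(i, j). ?M xs $$ (p i, j))"
    using assms pi by (intro eq_matI) (auto simp: mat_of_cols_index permute_list_nth)
  then have "det (?M (permute_list p xs)) = signof p * det (?M xs)"
    using p l by (simp only:, intro det_permute_rows) (auto simp: lessThan_atLeast0 carrier_matI)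
  moreover have "det (?M ys) = det (mat_of_cols d (map f ys))" if "length ys = d" for ys
    using that by (intro det_transpose) (auto intro: carrier_matI)
  ultimately show ?thesis
    using l by (simp add: sign_def split: if_splits)
qed

lemma det_mat_of_cols_not_distinct:
  fixes f :: "nat \<Rightarrow> 'a::comm_ring_1 vec"
  assumes "range f \<subseteq> carrier_vec d" "length xs = d" "\<not> distinct xs"
  shows "det (mat_of_cols d (map f xs)) = 0"
proof -
  obtain i j where ij: "i < d" "j < d" "i \<noteq> j" "xs ! i = xs ! j"
    using assms by (auto simp: distinct_conv_nth)
  moreover have "f x \<in> carrier_vec d" for x
    using assms(1) by blast
  ultimately show ?thesis
    using assms by (intro det_identical_columns[of _ d i j]) (auto intro!: carrier_matI)
qed

lemma det_grassmann_pluecker: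
  fixes f :: "nat \<Rightarrow> 'a::idom vec"
  assumes f: "range f \<subseteq> carrier_vec d" and xs: "length xs = d + 1" and ys: "length ys + 1 = d"
  defines "p \<equiv> \<lambda>xs. det (mat_of_cols d (map f xs))"
  shows "(\<Sum>k<d + 1. (-1) ^ k * p (take k xs @ drop (Suc k) xs) * p (xs ! k # ys)) = 0"
proof -
  txt \<open>Append to the matrix with columns \<open>xs\<close> the row of values \<open>p (x # ys)\<close>. It is a linear
    combination of the other rows, and expanding along it gives the relation.\<close>
  define c where "c = (\<lambda>i. cofactor (mat_of_cols d (map f (0 # ys))) i 0)"
  have pc: "p (x # ys) = (\<Sum>i<d. f x $ i * c i)" for x
  proof -
    have "p (x # ys) = (\<Sum>i<d. mat_of_cols d (map f (x # ys)) $$ (i, 0) * cofactor (mat_of_cols d (map f (x # ys))) i 0)"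
      unfolding p_def using ys by (intro laplace_expansion_column) (auto intro!: carrier_matI)
    \<comment> \<open>The minors without column 0 do not see \<open>x\<close>, so the placeholder
      index 0 in \<open>c\<close> is harmless.\<close>
    also have "mat_delete (mat_of_cols d (map f (x # ys))) i 0 = mat_delete (mat_of_cols d (map f (0 # ys))) i 0" for i
      by (intro eq_matI) (auto simp: mat_delete_def mat_of_cols_def)
    then have "(\<Sum>i<d. mat_of_cols d (map f (x # ys)) $$ (i, 0) * cofactor (mat_of_cols d (map f (x # ys))) i 0)
       = (\<Sum>i<d. f x $ i * c i)"
      by (intro sum.cong) (auto simp: c_def cofactor_def mat_of_cols_Cons_index_0)
    finally show ?thesis .
  qed
  define N where "N = mat (d + 1) (d + 1) (\<lambda>(i, k). if i < d then f (xs ! k) $ i else p (xs ! k # ys))"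
  have N: "N \<in> carrier_mat (d + 1) (d + 1)"
    by (simp add: N_def)
  \<comment> \<open>\<open>w\<close> records that the last row of \<open>N\<close> is the
    combination of the others with coefficients \<open>c\<close>; its entry \<open>- 1\<close> makes
    it nonzero.\<close>
  define w where "w = vec (d + 1) (\<lambda>i. if i < d then c i else - 1)"
  have "N\<^sup>T *\<^sub>v w = 0\<^sub>v (d + 1)"
    by (intro eq_vecI) (auto simp: N_def w_def scalar_prod_def pc lessThan_atLeast0)
  moreover have "w $ d \<noteq> 0\<^sub>v (d + 1) $ d"
    by (simp add: w_def)
  then have "w \<noteq> 0\<^sub>v (d + 1)"
    by metis
  moreover have "w \<in> carrier_vec (d + 1)"
    by (simp add: w_def)
  ultimately have "det (N\<^sup>T) = 0"
    using N by (subst det_0_iff_vec_prod_zero[of _ "d + 1"]) auto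
  then have "0 = det N"
    using det_transpose[OF N] by simp
  also have "\<dots> = (\<Sum>k<d + 1. N $$ (d, k) * cofactor N d k)"
    using N by (intro laplace_expansion_row) auto
  also have "\<dots> = (\<Sum>k<d + 1. (-1) ^ d * ((-1) ^ k * p (take k xs @ drop (Suc k) xs) * p (xs ! k # ys)))"
  proof (intro sum.cong refl)
    fix k assume k: "k \<in> {..<d + 1}"
    have "mat_delete N d k = mat_of_cols d (map f (take k xs @ drop (Suc k) xs))"
      using k xs by (intro eq_matI) (auto simp: mat_delete_def N_def mat_of_cols_index nth_append)
    with k show "N $$ (d, k) * cofactor N d k
        = (-1) ^ d * ((-1) ^ k * p (take k xs @ drop (Suc k) xs) * p (xs ! k # ys))"
      by (simp add: N_def cofactor_def p_def power_add)
  qed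
  finally show ?thesis
    by (simp flip: sum_distrib_left)
qed

section \<open>Phases and nondegenerate three-term relations\<close>

lemma phase_set_add_zero: "phase_set_add {0} A = A"
  by (auto simp: phase_set_add_def phase_add_def)

lemma phase_sum_filter: "phase_sum (filter (\<lambda>z. z \<noteq> 0) zs) = phase_sum zs"
  by (induction zs) (auto simp: phase_set_add_zero)

lemma zero_in_phase_sum_2: "u \<noteq> 0 \<Longrightarrow> 0 \<in> phase_sum [u, - u]"
  by (auto simp: phase_set_add_def phase_add_def)

text \<open>By the inequalities, \<open>u\<close>, \<open>v\<close>, \<open>w\<close> go round the
  circle in steps of less than half a turn, in the direction given by the sign of \<open>s\<close>.
  So \<open>- u\<close> is a positive combination of \<open>v\<close> and \<open>w\<close>, and
  \<open>u \<boxplus> - u\<close> contains 0.\<close>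

lemma zero_in_phase_sum_3:
  assumes norm: "norm u = 1" "norm v = 1" "norm w = 1"
    and pos: "Im (v * cnj u) * s > 0" "Im (w * cnj v) * s > 0" "Im (u * cnj w) * s > 0"
  shows "0 \<in> phase_sum [u, v, w]"
proof -
  \<comment> \<open>Cramer's rule: these are the coefficients of a linear dependence between three
    vectors in the plane.\<close>
  define \<alpha> \<beta> \<gamma> where "\<alpha> = Im (w * cnj v) * s" and "\<beta> = Im (u * cnj w) * s" and "\<gamma> = Im (v * cnj u) * s"
  have "of_real \<beta> * v + of_real \<gamma> * w = - (of_real \<alpha> * u)"
    by (simp add: complex_eq_iff \<alpha>_def \<beta>_def \<gamma>_def algebra_simps)
  moreover have "\<alpha> > 0" "\<beta> > 0" "\<gamma> > 0"
    using pos by (simp_all add: \<alpha>_def \<beta>_def \<gamma>_def)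
  ultimately have "- u = (of_real \<beta> * v + of_real \<gamma> * w) / of_real (norm (of_real \<beta> * v + of_real \<gamma> * w))"
    using norm by (simp add: norm_mult)
  moreover have nz: "u \<noteq> 0" "v \<noteq> 0" "w \<noteq> 0"
    using norm by auto
  moreover have "w \<noteq> - v"
    using pos(2) by (auto simp: algebra_simps)
  ultimately have "- u \<in> v \<boxplus> w"
    using \<open>\<beta> > 0\<close> \<open>\<gamma> > 0\<close> unfolding phase_add_def by auto
  moreover have "0 \<in> u \<boxplus> - u"
    using nz by (simp add: phase_add_def)
  moreover have "w \<boxplus> 0 = {w}"
    using nz by (simp add: phase_add_def)
  ultimately show ?thesis
    by (auto simp: phase_set_add_def)
qed

lemma ph_mult: "ph (x * y) = ph x * ph y"
  by (simp add: ph_eq_sgn sgn_mult)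

lemma ph_eq_0_iff: "ph z = 0 \<longleftrightarrow> z = 0"
  by (simp add: ph_eq_sgn sgn_zero_iff)

lemma norm_ph: "z \<noteq> 0 \<Longrightarrow> norm (ph z) = 1"
  by (simp add: ph_eq_sgn norm_sgn)

lemma ph_uminus: "ph (- z) = - ph z"
  by (simp add: ph_eq_sgn sgn_minus)

text \<open>The factor \<open>c\<close> cancels because its phase has norm 1, and normalizing
  \<open>x\<close> and \<open>y\<close> costs only a positive factor. As \<open>r\<close> does not
  depend on \<eta>, signs can be compared after any rotation.\<close>

lemma Im_ph_mult_cnj:
  assumes "c \<noteq> 0" "x \<noteq> 0" "y \<noteq> 0"
  obtains r where "r > 0" "\<And>\<eta>. Im (\<eta> * (ph (c * x) * cnj (ph (c * y)))) = r * Im (\<eta> * (x * cnj y))"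
proof
  let ?r = "1 / (norm x * norm y)"
  show "?r > 0"
    using assms by simp
  have "ph (c * x) * cnj (ph (c * y)) = (ph c * cnj (ph c)) * (ph x * cnj (ph y))"
    by (simp add: ph_mult)
  also have "ph c * cnj (ph c) = 1"
    using norm_ph[OF assms(1)] by (simp add: complex_norm_square[symmetric])
  finally have "ph (c * x) * cnj (ph (c * y)) = of_real ?r * (x * cnj y)"
    by (simp add: ph_def field_simps)
  then show "Im (\<eta> * (ph (c * x) * cnj (ph (c * y)))) = ?r * Im (\<eta> * (x * cnj y))" for \<eta>
    by (simp only: mult.left_commute[of \<eta>] Im_complex_of_real Re_complex_of_real times_complex.sel)
qed

section \<open>Small rotations and rigidity of three-term relations\<close>

text \<open>At angle 0 each of the finitely many expressions is \<open>Im z * Im z\<close>, so by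
  continuity all stay positive for small positive angles. Exponents go up to 2 because a summand of
  a relation contains two values of the phirotope.\<close>

lemma exists_small_rotation:
  assumes "finite Z"
  obtains \<omega> :: complex where "norm \<omega> = 1" "\<omega> \<noteq> 1"
    "\<And>z i j. \<lbrakk>z \<in> Z; Im z \<noteq> 0; i \<le> 2; j \<le> 2\<rbrakk> \<Longrightarrow> Im (\<omega> ^ i * cnj (\<omega> ^ j) * z) * Im z > 0"
proof -
  have "eventually (\<lambda>\<theta>. Im (cis \<theta> ^ i * cnj (cis \<theta> ^ j) * z) * Im z > 0) (at_right 0)"
    if "Im z \<noteq> 0" for z and i j :: nat
  proof (rule order_tendstoD)
    have "((\<lambda>\<theta>. Im (cis \<theta> ^ i * cnj (cis \<theta> ^ j) * z) * Im z)
        \<longlongrightarrow> Im (cis 0 ^ i * cnj (cis 0 ^ j) * z) * Im z) (at_right 0)"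
      by (intro tendsto_intros)
    then show "((\<lambda>\<theta>. Im (cis \<theta> ^ i * cnj (cis \<theta> ^ j) * z) * Im z) \<longlongrightarrow> Im z * Im z) (at_right 0)"
      by simp
    show "0 < Im z * Im z"
      using that by (simp add: zero_less_mult_iff linorder_neq_iff disj_commute)
  qed
  then have "eventually (\<lambda>\<theta>. \<forall>z\<in>{z \<in> Z. Im z \<noteq> 0}. \<forall>i\<in>{..2}. \<forall>j\<in>{..2}.
      Im (cis \<theta> ^ i * cnj (cis \<theta> ^ j) * z) * Im z > 0) (at_right 0)"
    using assms by (intro eventually_ball_finite ballI) auto
  \<comment> \<open>An angle strictly between 0 and \<pi> has positive sine, which keeps
    \<open>cis \<theta>\<close> different from 1.\<close>
  moreover have "eventually (\<lambda>\<theta>. \<theta> \<in> {0<..<1}) (at_right (0::real))"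
    by (rule eventually_at_right_real) simp
  ultimately have "eventually (\<lambda>\<theta>. (\<forall>z\<in>{z \<in> Z. Im z \<noteq> 0}. \<forall>i\<in>{..2}. \<forall>j\<in>{..2}.
      Im (cis \<theta> ^ i * cnj (cis \<theta> ^ j) * z) * Im z > 0) \<and> \<theta> \<in> {0<..<1}) (at_right 0)"
    by (rule eventually_conj)
  then obtain \<theta> where \<theta>: "\<theta> \<in> {0<..<1}" "\<forall>z\<in>{z \<in> Z. Im z \<noteq> 0}. \<forall>i\<in>{..2}. \<forall>j\<in>{..2}.
      Im (cis \<theta> ^ i * cnj (cis \<theta> ^ j) * z) * Im z > 0"
    using eventually_happens'[OF trivial_limit_at_right_real] by blast
  have "sin \<theta> > 0"
    using \<theta>(1) pi_ge_two by (intro sin_gt_zero) auto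
  then have "cis \<theta> \<noteq> 1"
    by (auto simp: complex_eq_iff)
  with \<theta>(2) show thesis
    by (intro that[of "cis \<theta>"]) auto
qed

text \<open>Dividing by the common phase of \<open>a\<close>, \<open>b\<close>, \<open>c\<close>
  gives the second relation real coefficients. As \<open>x\<close> and \<open>y\<close> are
  independent over the reals, \<open>x + y + z = 0\<close> is the only real relation up to scaling.
  This is what forces the cross ratios of a realization.\<close>

lemma ph_eq_rigidity:
  assumes sum: "x + y + z = 0" "a * x + b * y + c * z = 0"
    and "ph a = ph b" "ph c = ph b" "b \<noteq> 0" and indep: "Im (y * cnj x) \<noteq> 0"
  shows "a = b" "c = b"
proof -
  define h where "h = ph b"
  have ph: "w = of_real (norm w) * ph w" for w
    by (simp add: ph_def)
  have h: "h \<noteq> 0" "b = of_real (norm b) * h" "a = of_real (norm a) * h" "c = of_real (norm c) * h"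
    using ph[of a] ph[of b] ph[of c] assms(3-5) by (simp_all add: h_def ph_eq_0_iff)
  have "h * (of_real (norm a) * x + of_real (norm b) * y + of_real (norm c) * z) = 0"
    using sum(2) by (subst (asm) h(2), subst (asm) h(3), subst (asm) h(4)) (simp add: algebra_simps)
  moreover have z: "z = - x - y"
    using sum(1) by (simp add: eq_neg_iff_add_eq_0 algebra_simps)
  ultimately have *: "of_real (norm a - norm c) * x + of_real (norm b - norm c) * y = 0"
    using h(1) by (simp add: left_diff_distrib right_diff_distrib add.assoc diff_diff_eq add_diff_eq diff_add_eq)
  \<comment> \<open>Multiplying by \<open>cnj x\<close> makes the term of \<open>x\<close> real, so
    the imaginary part isolates the coefficient of \<open>y\<close>.\<close>
  have "Im ((of_real (norm a - norm c) * x + of_real (norm b - norm c) * y) * cnj x)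
      = (norm b - norm c) * Im (y * cnj x)"
    by (simp add: algebra_simps)
  then have "(norm b - norm c) * Im (y * cnj x) = 0"
    by (simp only: * mult_zero_left zero_complex.sel)
  then have bc: "norm b = norm c"
    using indep by (simp only: mult_eq_0_iff) simp
  moreover have "x \<noteq> 0"
    using indep by auto
  ultimately have "norm a = norm c"
    using * by simp
  with bc h show "a = b" "c = b"
    by metis+
qed

text \<open>A circle meets the parabola \<open>y = x\<^sup>2\<close> in points whose abscissae sum to \<open>0\<close>, and a line meets
  it at most twice, so no four of these points are concyclic or collinear: all their cross ratios
  are nonreal.\<close>

definition parabola :: "nat \<Rightarrow> complex" where
  "parabola k = Complex (real k) (real k ^ 2)"

lemma inj_parabola: "inj parabola"
  by (auto simp: inj_def parabola_def)

lemma parabola_diff: "parabola y - parabola x = of_real (real y - real x) * Complex 1 (real y + real x)"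
  by (simp add: parabola_def complex_eq_iff power2_eq_square algebra_simps)

text \<open>The three-term Grassmann-Pluecker relation of rank 2, divided by the common Vandermonde
  factor; clearing denominators leaves a polynomial identity.\<close>

lemma gp_quot_sum:
  fixes t :: "nat \<Rightarrow> 'a::field"
  assumes "inj t" "distinct [a, b, c]"
  shows "gp_quot t {a, b, c} {e} a + gp_quot t {a, b, c} {e} b + gp_quot t {a, b, c} {e} c = 0"
proof -
  have "{a, b, c} - {a} = {b, c}" "{a, b, c} - {b} = {a, c}" "{a, b, c} - {c} = {a, b}"
    using assms by auto
  moreover have "t a \<noteq> t b" "t a \<noteq> t c" "t b \<noteq> t c"
    using assms by (simp_all add: inj_eq)
  ultimately show ?thesis
    using assms(2) by (simp add: gp_quot_def divide_simps) (simp add: algebra_simps)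
qed

lemma gp_quot_neq_0:
  assumes "inj t" "finite I" "finite J" "a \<notin> J"
  shows "gp_quot t I J a \<noteq> 0"
  using assms by (auto simp: gp_quot_def inj_eq)

text \<open>Up to a nonzero real factor, \<open>g b * cnj (g a)\<close> is a cross ratio of the four
  nodes. Its imaginary part is a product of nonzero differences with the sum
  \<open>a + b + c + e\<close>, which is positive for distinct natural numbers.\<close>

lemma Im_gp_quot_parabola:
  assumes "distinct [a, b, c, e]"
  defines "g \<equiv> gp_quot parabola {a, b, c} {e}"
  shows "Im (g b * cnj (g a)) \<noteq> 0"
proof -
  let ?t = parabola
  define D where "D = (\<lambda>x y. Complex 1 (real y + real x))"
  have "{a, b, c} - {a} = {b, c}" "{a, b, c} - {b} = {a, c}"
    using assms(1) by auto
  then have "g b * cnj (g a) = (?t e - ?t b) * cnj (?t e - ?t a)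
      / ((?t a - ?t b) * (?t c - ?t b) * cnj ((?t b - ?t a) * (?t c - ?t a)))"
    using assms(1) by (simp add: g_def gp_quot_def)
  \<comment> \<open>Expanding the fraction by \<open>cnj (?t c - ?t b) * (?t c - ?t a)\<close> makes
    the denominator real.\<close>
  also have "\<dots> = (?t e - ?t b) * cnj (?t e - ?t a) * cnj (?t c - ?t b) * (?t c - ?t a)
      / of_real (- (norm (?t a - ?t b) * norm (?t c - ?t b) * norm (?t c - ?t a))\<^sup>2)"
  proof -
    have "((?t a - ?t b) * (?t c - ?t b) * cnj ((?t b - ?t a) * (?t c - ?t a))) * (cnj (?t c - ?t b) * (?t c - ?t a))
      = - (((?t a - ?t b) * cnj (?t a - ?t b)) * ((?t c - ?t b) * cnj (?t c - ?t b)) * ((?t c - ?t a) * cnj (?t c - ?t a)))"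
      by (simp add: algebra_simps)
    also have "\<dots> = of_real (- (norm (?t a - ?t b) * norm (?t c - ?t b) * norm (?t c - ?t a))\<^sup>2)"
      by (simp only: complex_norm_square[symmetric] power_mult_distrib of_real_minus of_real_mult of_real_power)
    finally have "((?t a - ?t b) * (?t c - ?t b) * cnj ((?t b - ?t a) * (?t c - ?t a))) * (cnj (?t c - ?t b) * (?t c - ?t a))
      = of_real (- (norm (?t a - ?t b) * norm (?t c - ?t b) * norm (?t c - ?t a))\<^sup>2)" .
    moreover have "cnj (?t c - ?t b) * (?t c - ?t a) \<noteq> 0"
      using assms(1) by (simp add: inj_eq[OF inj_parabola])
    ultimately show ?thesis
      by (metis mult.assoc nonzero_mult_divide_mult_cancel_right)
  qed
  also have "(?t e - ?t b) * cnj (?t e - ?t a) * cnj (?t c - ?t b) * (?t c - ?t a)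
     = of_real ((real e - real b) * (real e - real a) * (real c - real b) * (real c - real a))
       * (D b e * cnj (D a e) * cnj (D b c) * D a c)"
    by (simp add: parabola_diff D_def)
  finally have "g b * cnj (g a) = of_real (((real e - real b) * (real e - real a) * (real c - real b) * (real c - real a))
       / (- (norm (?t a - ?t b) * norm (?t c - ?t b) * norm (?t c - ?t a))\<^sup>2))
       * (D b e * cnj (D a e) * cnj (D b c) * D a c)"
    by simp
  moreover have "Im (D b e * cnj (D a e) * cnj (D b c) * D a c)
     = (real a + real b + real c + real e) * (real e - real c) * (real a - real b)"
    by (simp add: D_def algebra_simps)
  ultimately show ?thesis
    using assms(1) by (simp add: inj_eq[OF inj_parabola])
qed

section \<open>The twisted Vandermonde phirotope\<close>

definition twist :: "nat set \<Rightarrow> complex \<Rightarrow> nat set \<Rightarrow> complex" where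
  "twist B \<omega> X = (if X = B then \<omega> else 1)"

definition twisted_phirotope :: "nat \<Rightarrow> nat \<Rightarrow> nat set \<Rightarrow> complex \<Rightarrow> nat list \<Rightarrow> complex" where
  "twisted_phirotope d m B \<omega> = (\<lambda>xs\<in>tuples d m. twist B \<omega> (set xs) * ph (vandermonde parabola xs))"

text \<open>The summand of a relation of the twisted phirotope in which \<open>x\<close> moves from
  \<open>I\<close> to \<open>J\<close>; \<open>C\<close> is the factor shared by all
  summands.\<close>

definition gp_phase :: "nat set \<Rightarrow> complex \<Rightarrow> complex \<Rightarrow> nat set \<Rightarrow> nat set \<Rightarrow> nat \<Rightarrow> complex" where
  "gp_phase B \<omega> C I J x =
     twist B \<omega> (I - {x}) * twist B \<omega> (insert x J) * ph (C * gp_quot parabola I J x)"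

text \<open>The openness condition: the powers of \<omega> that can arise when two summands are
  compared do not change the sign of the imaginary part.\<close>

definition small_rotation :: "nat \<Rightarrow> complex \<Rightarrow> bool" where
  "small_rotation m \<omega> \<longleftrightarrow> (\<forall>a\<in>{1..m}. \<forall>b\<in>{1..m}. \<forall>c\<in>{1..m}. \<forall>e\<in>{1..m}. \<forall>i\<le>2. \<forall>j\<le>2.
     distinct [a, b, c, e] \<longrightarrow>
     Im (\<omega> ^ i * cnj (\<omega> ^ j) *
         (gp_quot parabola {a, b, c} {e} b * cnj (gp_quot parabola {a, b, c} {e} a)))
     * Im (gp_quot parabola {a, b, c} {e} b * cnj (gp_quot parabola {a, b, c} {e} a)) > 0)"

lemma exists_small_rotation_parabola:
  obtains \<omega> where "norm \<omega> = 1" "\<omega> \<noteq> 1" "small_rotation m \<omega>"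
proof -
  define h where "h = (\<lambda>(a, b, c, e). gp_quot parabola {a, b, c} {e} b * cnj (gp_quot parabola {a, b, c} {e} a))"
  define Z where "Z = h ` ({1..m} \<times> {1..m} \<times> {1..m} \<times> {1..m})"
  have "finite Z"
    by (simp add: Z_def)
  then obtain \<omega> where \<omega>: "norm \<omega> = 1" "\<omega> \<noteq> 1"
    "\<And>z i j. \<lbrakk>z \<in> Z; Im z \<noteq> 0; i \<le> 2; j \<le> 2\<rbrakk> \<Longrightarrow> Im (\<omega> ^ i * cnj (\<omega> ^ j) * z) * Im z > 0"
    by (rule exists_small_rotation) blast
  have Z: "h (a, b, c, e) \<in> Z" if "a \<in> {1..m}" "b \<in> {1..m}" "c \<in> {1..m}" "e \<in> {1..m}" for a b c e
    using that unfolding Z_def by blast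
  have "small_rotation m \<omega>"
    unfolding small_rotation_def
    using \<omega>(3)[OF Z] Im_gp_quot_parabola by (simp add: h_def del: atLeastAtMost_iff)
  with \<omega> that show thesis
    by blast
qed

lemma set_remove_nth:
  assumes "distinct xs" "k < length xs"
  shows "set (take k xs @ drop (Suc k) xs) = set xs - {xs ! k}"
proof -
  have xs: "xs = take k xs @ xs ! k # drop (Suc k) xs"
    using assms(2) by (rule id_take_nth_drop)
  have "set (us @ vs) = set (us @ a # vs) - {a}" if "distinct (us @ a # vs)" for us vs :: "'a list" and a
    using that by auto
  from this[of "take k xs" "xs ! k" "drop (Suc k) xs", folded xs, OF assms(1)] show ?thesis .
qed

lemma tuples_remove:
  assumes "xs \<in> tuples (d + 1) m" "distinct xs" "k < d + 1"
  shows "take k xs @ drop (Suc k) xs \<in> tuples d m"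
    and "set (take k xs @ drop (Suc k) xs) = set xs - {xs ! k}"
proof -
  have l: "length xs = d + 1"
    using assms(1) by (simp add: tuples_def)
  then show s: "set (take k xs @ drop (Suc k) xs) = set xs - {xs ! k}"
    using assms(2,3) by (intro set_remove_nth) simp_all
  have "length (take k xs @ drop (Suc k) xs) = d"
    using l assms(3) by simp
  with s assms(1) show "take k xs @ drop (Suc k) xs \<in> tuples d m"
    unfolding tuples_def by blast
qed

lemma twisted_phirotope_gp_terms:
  fixes B \<omega>
  assumes "2 \<le> d" "xs \<in> tuples (d + 1) m" "distinct xs" "ys \<in> tuples (d - 1) m" "distinct ys"
  defines "\<phi> \<equiv> twisted_phirotope d m B \<omega>"
  obtains C where "C \<noteq> 0"
    "map (\<lambda>k. (-1) ^ k * \<phi> (take (k - 1) xs @ drop k xs) * \<phi> (xs ! (k - 1) # ys)) [1..<d + 2]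
     = map (gp_phase B \<omega> C (set xs) (set ys)) xs"
proof
  \<comment> \<open>The relations count from 1 and list positions from 0, hence the minus
    sign.\<close>
  let ?C = "- (vandermonde parabola xs * vandermonde parabola ys)"
  show "?C \<noteq> 0"
    using assms by (simp add: vandermonde_eq_0_iff inj_parabola)
  have l: "length xs = d + 1"
    using assms by (simp add: tuples_def)
  show "map (\<lambda>k. (-1) ^ k * \<phi> (take (k - 1) xs @ drop k xs) * \<phi> (xs ! (k - 1) # ys)) [1..<d + 2]
     = map (gp_phase B \<omega> ?C (set xs) (set ys)) xs"
  proof (rule nth_equalityI)
    fix k assume "k < length (map (\<lambda>k. (-1) ^ k * \<phi> (take (k - 1) xs @ drop k xs) * \<phi> (xs ! (k - 1) # ys)) [1..<d + 2])"
    then have k: "k < d + 1"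
      by (simp del: upt_Suc)
    have "xs ! k \<in> set xs"
      using k l by simp
    then have "xs ! k # ys \<in> tuples d m"
      using assms by (auto simp: tuples_def)
    note t = this tuples_remove[OF assms(2,3) k]
    have ph1: "ph ((-1) ^ Suc k) = (-1) ^ Suc k"
      by (cases "even k") (simp_all add: ph_def)
    let ?v = "vandermonde parabola (take k xs @ drop (Suc k) xs)" and ?w = "vandermonde parabola (xs ! k # ys)"
    have "(-1) ^ Suc k * ?v * ?w = ?C * gp_quot parabola (set xs) (set ys) (xs ! k)"
      using vandermonde_gp_term[OF inj_parabola assms(3,5), of k] k l by simp
    from this[symmetric] have phC: "ph (?C * gp_quot parabola (set xs) (set ys) (xs ! k)) = (-1) ^ Suc k * ph ?v * ph ?w"
      by (simp only: ph_mult ph1)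
    have v: "\<phi> (take k xs @ drop (Suc k) xs) = twist B \<omega> (set xs - {xs ! k}) * ph ?v"
      unfolding \<phi>_def twisted_phirotope_def using t(2) by (simp only: restrict_apply if_True t(3))
    have w: "\<phi> (xs ! k # ys) = twist B \<omega> (insert (xs ! k) (set ys)) * ph ?w"
      unfolding \<phi>_def twisted_phirotope_def using t(1) by (simp only: restrict_apply if_True list.set(2))
    have "(-1) ^ Suc k * \<phi> (take k xs @ drop (Suc k) xs) * \<phi> (xs ! k # ys)
      = gp_phase B \<omega> ?C (set xs) (set ys) (xs ! k)"
      by (simp only: gp_phase_def phC v w mult_ac)
    then show "map (\<lambda>k. (-1) ^ k * \<phi> (take (k - 1) xs @ drop k xs) * \<phi> (xs ! (k - 1) # ys)) [1..<d + 2] ! k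
     = map (gp_phase B \<omega> ?C (set xs) (set ys)) xs ! k"
      using k l by (simp del: upt_Suc)
  qed (use l in simp)
qed

text \<open>Once \<open>S\<close> and \<open>C\<close> are cancelled,
  \<open>\<tau> b * cnj (\<tau> a)\<close> differs from \<open>g b * cnj (g a)\<close> by a positive
  factor and by powers of \<omega> with exponents at most 2, which \<open>small_rotation\<close>
  allows.\<close>

lemma gp_phase_nonreal:
  fixes B
  assumes "norm \<omega> = 1" "small_rotation m \<omega>" "C \<noteq> 0"
    and "distinct [a, b, c, e]" "{a, b, c, e} \<subseteq> {1..m}" "finite S" "S \<inter> {a, b, c, e} = {}"
  defines "g \<equiv> gp_quot parabola {a, b, c} {e}"
    and "\<tau> \<equiv> gp_phase B \<omega> C (S \<union> {a, b, c}) (S \<union> {e})"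
  shows "Im (\<tau> b * cnj (\<tau> a)) * Im (g b * cnj (g a)) > 0"
proof -
  have tw: "\<exists>i\<le>2. twist B \<omega> X * twist B \<omega> Y = \<omega> ^ i" for X Y
    unfolding twist_def
    by (cases "X = B"; cases "Y = B")
      (auto intro: exI[of _ 0] exI[of _ 1] exI[of _ 2] simp: power2_eq_square)
  have \<tau>_eq: "\<exists>i\<le>2. \<tau> x = \<omega> ^ i * ph (C * g x)" if "x \<in> {a, b, c}" for x
  proof -
    have "gp_quot parabola (S \<union> {a, b, c}) (S \<union> {e}) x = g x"
      unfolding g_def using that assms(6,7) by (intro gp_quot_cancel[OF inj_parabola]) auto
    then show ?thesis
      using tw[of "S \<union> {a, b, c} - {x}" "insert x (S \<union> {e})"] by (auto simp: \<tau>_def gp_phase_def)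
  qed
  obtain i where i: "i \<le> 2" "\<tau> b = \<omega> ^ i * ph (C * g b)"
    using \<tau>_eq[of b] by auto
  moreover obtain j where j: "j \<le> 2" "\<tau> a = \<omega> ^ j * ph (C * g a)"
    using \<tau>_eq[of a] by auto
  ultimately have ij: "i \<le> 2" "j \<le> 2" "\<tau> b = \<omega> ^ i * ph (C * g b)" "\<tau> a = \<omega> ^ j * ph (C * g a)"
    by simp_all
  have "g b \<noteq> 0" "g a \<noteq> 0"
    using assms(4) by (simp_all add: g_def gp_quot_neq_0 inj_parabola)
  with assms(3) obtain r where r: "r > 0"
    "\<And>\<eta>. Im (\<eta> * (ph (C * g b) * cnj (ph (C * g a)))) = r * Im (\<eta> * (g b * cnj (g a)))"
    using Im_ph_mult_cnj by metis
  have "Im (\<tau> b * cnj (\<tau> a)) = Im (\<omega> ^ i * cnj (\<omega> ^ j) * (ph (C * g b) * cnj (ph (C * g a))))"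
    by (simp only: ij complex_cnj_mult mult_ac)
  also have "\<dots> = r * Im (\<omega> ^ i * cnj (\<omega> ^ j) * (g b * cnj (g a)))"
    by (rule r(2))
  finally have "Im (\<tau> b * cnj (\<tau> a)) * Im (g b * cnj (g a))
    = r * (Im (\<omega> ^ i * cnj (\<omega> ^ j) * (g b * cnj (g a))) * Im (g b * cnj (g a)))"
    by simp
  moreover have "Im (\<omega> ^ i * cnj (\<omega> ^ j) * (g b * cnj (g a))) * Im (g b * cnj (g a)) > 0"
    using assms(2,4,5) ij(1,2) unfolding small_rotation_def g_def by simp
  ultimately show ?thesis
    using r(1) by (metis mult_pos_pos)
qed

text \<open>Summands at elements of \<open>J\<close> vanish, so two or three remain. Two cancel each
  other; three surround 0 by \<open>gp_phase_nonreal\<close>.\<close>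

lemma weak_GP_relations_twisted_phirotope:
  assumes "2 \<le> d" and \<omega>: "norm \<omega> = 1" "small_rotation m \<omega>"
  shows "weak_GP_relations d m (twisted_phirotope d m B \<omega>)"
  unfolding weak_GP_relations_def
proof (intro ballI impI)
  let ?\<phi> = "twisted_phirotope d m B \<omega>"
  fix xs ys
  assume xs: "xs \<in> tuples (d + 1) m" and ys: "ys \<in> tuples (d - 1) m"
    and dist: "distinct xs \<and> distinct ys \<and> card (set xs - set ys) \<le> 3"
  define I J S where "I = set xs" and "J = set ys" and "S = I \<inter> J"
  have [simp]: "finite I" "finite J" "finite S"
    by (simp_all add: I_def J_def S_def)
  obtain C where C: "C \<noteq> 0"
    "map (\<lambda>k. (-1) ^ k * ?\<phi> (take (k - 1) xs @ drop k xs) * ?\<phi> (xs ! (k - 1) # ys)) [1..<d + 2]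
     = map (gp_phase B \<omega> C I J) xs"
    using twisted_phirotope_gp_terms[OF assms(1) xs _ ys] dist unfolding I_def J_def by blast
  define \<tau> where "\<tau> = gp_phase B \<omega> C I J"
  have tw: "norm (twist B \<omega> X) = 1" for X
    using \<omega> by (simp add: twist_def)
  then have tw0: "twist B \<omega> X \<noteq> 0" for X
    by (metis norm_zero zero_neq_one)
  have \<tau>0: "\<tau> x = 0 \<longleftrightarrow> x \<in> J" for x
    using C(1) tw0 gp_quot_neq_0[OF inj_parabola, of I J x] gp_quot_eq_0[of J x parabola I]
    by (auto simp: \<tau>_def gp_phase_def ph_eq_0_iff)
  have norm_\<tau>: "norm (\<tau> x) = 1" if "x \<notin> J" for x
    using C(1) that tw gp_quot_neq_0[OF inj_parabola, of I J x]
    by (simp add: \<tau>_def gp_phase_def norm_mult norm_ph)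
  define zs where "zs = filter (\<lambda>x. x \<notin> J) xs"
  have zs: "distinct zs" "set zs = I - J"
    using dist by (auto simp: zs_def I_def)
  have "filter (\<lambda>z. z \<noteq> 0) (map \<tau> xs) = map \<tau> zs"
    by (simp add: filter_map zs_def o_def \<tau>0)
  then have sum: "phase_sum (map \<tau> xs) = phase_sum (map \<tau> zs)"
    by (metis phase_sum_filter)
  have card: "card I = d + 1" "card J = d - 1"
    using xs ys dist by (auto simp: I_def J_def tuples_def distinct_card)
  have "card I = card (I - J) + card S" "card J = card (J - I) + card S"
    using card_Diff_subset_Int[of I J] card_Diff_subset_Int[of J I] card_mono[of I S] card_mono[of J S]
    by (auto simp: S_def Int_commute)
  with card assms(1) have card_zs: "length zs = card (J - I) + 2"
    using zs distinct_card[of zs] by simp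
  have I: "I = S \<union> set zs" and J: "J = S \<union> (J - I)" and S: "S \<inter> set zs = {}"
    using zs by (auto simp: S_def)
  have "length zs \<le> 3"
    using dist zs distinct_card[of zs] by (simp add: I_def J_def)
  then consider "length zs = 2" | "length zs = 3"
    using card_zs by linarith
  then have "0 \<in> phase_sum (map \<tau> zs)"
  proof cases
    case 1
    then obtain a b where ab: "zs = [a, b]"
      by (auto simp: numeral_eq_Suc length_Suc_conv)
    have "a \<noteq> b" "a \<notin> J" "b \<notin> J"
      using zs ab by auto
    have JI: "J - I = {}"
      using card_zs 1 by simp
    then have JS: "J = S" and I': "I = S \<union> {a, b}"
      using I J ab by auto
    \<comment> \<open>Both summands involve the same two bases, so their twists agree and only the
      sign differs.\<close>
    then have "I - {a} = insert b J" "I - {b} = insert a J"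
      using \<open>a \<noteq> b\<close> \<open>a \<notin> J\<close> \<open>b \<notin> J\<close> by auto
    moreover have "gp_quot parabola I J x = gp_quot parabola {a, b} {} x" if "x \<in> {a, b}" for x
      using gp_quot_cancel[OF inj_parabola, of S x "{a, b}" "{}"] that S ab JS I' by auto
    moreover have "gp_quot parabola {a, b} {} b = - gp_quot parabola {a, b} {} a"
    proof -
      have "{a, b} - {a} = {b}" "{a, b} - {b} = {a}"
        using \<open>a \<noteq> b\<close> by auto
      then show ?thesis
        by (simp add: gp_quot_def) (metis minus_diff_eq minus_divide_right)
    qed
    ultimately have "\<tau> b = - \<tau> a"
      by (simp add: \<tau>_def gp_phase_def ph_uminus)
    with ab show ?thesis
      using zero_in_phase_sum_2[of "\<tau> a"] \<tau>0 \<open>a \<notin> J\<close> by simp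
  next
    case 2
    then obtain a b c where abc: "zs = [a, b, c]"
      by (auto simp: numeral_eq_Suc length_Suc_conv)
    have "card (J - I) = 1"
      using card_zs 2 by simp
    then obtain e where e: "J - I = {e}"
      by (rule card_1_singletonE)
    have I': "I = S \<union> {a, b, c}" and J': "J = S \<union> {e}"
      using I J e abc by auto
    have d: "distinct [a, b, c, e]"
      using zs abc e by auto
    have sub: "{a, b, c, e} \<subseteq> {1..m}"
    proof -
      have "I \<subseteq> {1..m}" "J \<subseteq> {1..m}"
        using xs ys by (simp_all add: I_def J_def tuples_def)
      moreover have "e \<in> J" "{a, b, c} \<subseteq> I"
        using e I' by blast+
      ultimately show ?thesis
        by blast
    qed
    have "e \<notin> S"
      using e unfolding S_def by blast
    with S have S': "S \<inter> {a, b, c, e} = {}"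
      by (simp add: abc)
    define g where "g = gp_quot parabola {a, b, c} {e}"
    note nr = gp_phase_nonreal[OF \<omega> C(1), where B = B and S = S]
    have 1: "Im (\<tau> b * cnj (\<tau> a)) * Im (g b * cnj (g a)) > 0"
      using nr[of a b c e] d sub S' by (simp add: \<tau>_def g_def I' J')
    have 2: "Im (\<tau> c * cnj (\<tau> b)) * Im (g c * cnj (g b)) > 0"
      using nr[of b c a e] d sub S' by (simp add: \<tau>_def g_def I' J' insert_commute)
    have 3: "Im (\<tau> a * cnj (\<tau> c)) * Im (g a * cnj (g c)) > 0"
      using nr[of c a b e] d sub S' by (simp add: \<tau>_def g_def I' J' insert_commute)
    have gc: "g c = - g a - g b"
      using gp_quot_sum[OF inj_parabola, of a b c e] d
      by (simp add: g_def eq_neg_iff_add_eq_0 algebra_simps)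
    \<comment> \<open>Since the three values of \<open>g\<close> sum to 0, the cyclic imaginary
      parts coincide; their common value serves as the orientation \<open>s\<close>.\<close>
    have eq: "Im (g c * cnj (g b)) = Im (g b * cnj (g a))" "Im (g a * cnj (g c)) = Im (g b * cnj (g a))"
      unfolding gc by (simp_all add: algebra_simps)
    have norms: "norm (\<tau> a) = 1" "norm (\<tau> b) = 1" "norm (\<tau> c) = 1"
      using zs abc norm_\<tau> by auto
    show ?thesis
      unfolding abc list.map by (rule zero_in_phase_sum_3[OF norms 1 2[unfolded eq] 3[unfolded eq]])
  qed
  then show "0 \<in> phase_sum (map (\<lambda>k. (-1) ^ k * ?\<phi> (take (k - 1) xs @ drop k xs) * ?\<phi> (xs ! (k - 1) # ys)) [1..<d + 2])"
    by (simp only: C(2) sum \<tau>_def[symmetric])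
qed

section \<open>Support, alternation and the uniform matroid\<close>

lemma twisted_phirotope_eq_0_iff:
  assumes "norm \<omega> = 1" "xs \<in> tuples d m"
  shows "twisted_phirotope d m B \<omega> xs = 0 \<longleftrightarrow> \<not> distinct xs"
  using assms by (auto simp: twisted_phirotope_def twist_def ph_eq_0_iff vandermonde_eq_0_iff inj_parabola)

lemma alternating_on_twisted_phirotope:
  assumes "norm \<omega> = 1"
  shows "alternating_on d m (twisted_phirotope d m B \<omega>)"
  unfolding alternating_on_def
proof (intro conjI ballI allI impI)
  fix xs p assume xs: "xs \<in> tuples d m" and p: "p permutes {..<d}"
  have l: "length xs = d"
    using xs by (simp add: tuples_def)
  then have "permute_list p xs \<in> tuples d m"
    using xs p by (simp add: tuples_def)
  moreover have "ph (of_int (sign p)) = of_int (sign p)"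
    by (simp add: sign_def ph_def)
  ultimately show "twisted_phirotope d m B \<omega> (permute_list p xs)
      = of_int (sign p) * twisted_phirotope d m B \<omega> xs"
    using xs p l by (simp add: twisted_phirotope_def vandermonde_permute_list ph_mult)
qed (use assms twisted_phirotope_eq_0_iff in blast)

lemma support_sets_twisted_phirotope:
  assumes "norm \<omega> = 1"
  shows "support_sets d m (twisted_phirotope d m B \<omega>) = uniform_bases d m"
proof -
  have "support_sets d m (twisted_phirotope d m B \<omega>) = {set xs | xs. xs \<in> tuples d m \<and> distinct xs}"
    using assms by (auto simp: support_sets_def twisted_phirotope_eq_0_iff)
  also have "\<dots> = uniform_bases d m"
  proof (intro equalityI subsetI)
    fix X assume "X \<in> uniform_bases d m"
    then have "X = set (sorted_list_of_set X)" "sorted_list_of_set X \<in> tuples d m" "distinct (sorted_list_of_set X)"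
      by (auto simp: uniform_bases_def tuples_def finite_subset[of X "{1..m}"])
    then show "X \<in> {set xs | xs. xs \<in> tuples d m \<and> distinct xs}"
      by blast
  qed (auto simp: uniform_bases_def tuples_def distinct_card)
  finally show ?thesis .
qed

lemma matroid_bases_uniform_bases:
  assumes "d \<le> m"
  shows "matroid_bases {1..m} (uniform_bases d m)"
  unfolding matroid_bases_def
proof (intro conjI ballI)
  have "{1..d} \<in> uniform_bases d m"
    using assms by (simp add: uniform_bases_def)
  then show "uniform_bases d m \<noteq> {}"
    by blast
  fix X Y x assume XY: "X \<in> uniform_bases d m" "Y \<in> uniform_bases d m" and x: "x \<in> X - Y"
  then have fin: "finite X" "finite Y" and card: "card X = d" "card Y = d"
    by (auto simp: uniform_bases_def dest: finite_subset)
  have "\<not> Y \<subseteq> X"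
    using card_subset_eq[OF fin(1), of Y] card x by auto
  then obtain y where y: "y \<in> Y - X"
    by blast
  have "card X > 0"
    using x fin by (auto simp: card_gt_0_iff)
  then have "insert y (X - {x}) \<in> uniform_bases d m"
    using XY x y fin card by (auto simp: uniform_bases_def)
  with y show "\<exists>y\<in>Y - X. insert y (X - {x}) \<in> uniform_bases d m"
    by blast
qed (auto simp: uniform_bases_def)

lemma twisted_phirotope_weak_GP:
  assumes "2 \<le> d" "d \<le> m" "norm \<omega> = 1" "small_rotation m \<omega>"
  shows "twisted_phirotope d m B \<omega> \<in> weak_GP_functions_over d m (uniform_bases d m)"
proof -
  have "twisted_phirotope d m B \<omega> \<in> tuples d m \<rightarrow>\<^sub>E phases"
    using assms(3) by (auto simp: twisted_phirotope_def twist_def phases_def norm_mult ph_def norm_divide)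
  moreover have "[1..<d + 1] \<in> tuples d m"
    using assms(2) by (auto simp: tuples_def)
  then have "\<exists>xs\<in>tuples d m. twisted_phirotope d m B \<omega> xs \<noteq> 0"
    using twisted_phirotope_eq_0_iff[OF assms(3)] distinct_upt by blast
  ultimately show ?thesis
    using assms matroid_bases_uniform_bases[OF assms(2)]
    by (simp add: weak_GP_functions_over_def weak_GP_functions_def support_sets_twisted_phirotope
        alternating_on_twisted_phirotope weak_GP_relations_twisted_phirotope)
qed

section \<open>Nonrealizability\<close>

text \<open>Both the minors of \<open>A\<close> and the Vandermonde products are alternating, so
  reordering changes them by the same sign and their quotient depends on the set only.\<close>

lemma realization_ratio:
  fixes A :: "'a::field mat"
  assumes "A \<in> carrier_mat d m" "inj t"
  obtains R :: "nat set \<Rightarrow> 'a" where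
    "\<And>xs. length xs = d \<Longrightarrow> det (mat_of_cols d (map (\<lambda>i. col A (i - 1)) xs)) = R (set xs) * vandermonde t xs"
proof
  define p where "p = (\<lambda>xs. det (mat_of_cols d (map (\<lambda>i. col A (i - 1)) xs)))"
  define R where "R = (\<lambda>X. p (sorted_list_of_set X) / vandermonde t (sorted_list_of_set X))"
  have col: "range (\<lambda>i. col A (i - 1)) \<subseteq> carrier_vec d"
    using assms(1) by (auto simp: col_def)
  fix xs :: "nat list"
  assume l: "length xs = d"
  have "p xs = R (set xs) * vandermonde t xs"
  proof (cases "distinct xs")
    case True
    let ?ys = "sorted_list_of_set (set xs)"
    have "mset xs = mset ?ys"
      using True by (simp add: set_eq_iff_mset_eq_distinct[symmetric])
    then obtain \<pi> where \<pi>: "\<pi> permutes {..<length ?ys}" "permute_list \<pi> ?ys = xs"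
      by (rule mset_eq_permutation)
    have "length ?ys = d"
      using l True by (simp add: distinct_card)
    with \<pi> have "p xs = of_int (sign \<pi>) * p ?ys"
      using det_mat_of_cols_permute_list[of \<pi> d ?ys "\<lambda>i. col A (i - 1)"] by (simp add: p_def)
    moreover have "vandermonde t xs = of_int (sign \<pi>) * vandermonde t ?ys"
      using vandermonde_permute_list[OF \<pi>(1), of t] \<pi>(2) by simp
    moreover have "vandermonde t ?ys \<noteq> 0"
      using vandermonde_eq_0_iff[OF assms(2)] by simp
    ultimately show ?thesis
      by (simp add: R_def)
  next
    case False
    then show ?thesis
      using det_mat_of_cols_not_distinct[OF col l] vandermonde_eq_0_iff[OF assms(2)] by (simp add: p_def)
  qed
  then show "det (mat_of_cols d (map (\<lambda>i. col A (i - 1)) xs)) = R (set xs) * vandermonde t xs"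
    by (simp add: p_def)
qed

text \<open>The Grassmann-Pluecker relation of \<open>A\<close>, divided by the common Vandermonde
  factor \<open>v\<close>. It is the relation of \<open>gp_quot_sum\<close> with each term weighted
  by a product of two ratios.\<close>

lemma realization_ratio_relation:
  fixes A :: "'a::field mat" and t :: "nat \<Rightarrow> 'a"
  assumes A: "A \<in> carrier_mat d m" and "inj t"
    and R: "\<And>xs. length xs = d \<Longrightarrow> det (mat_of_cols d (map (\<lambda>i. col A (i - 1)) xs)) = R (set xs) * vandermonde t xs"
    and S: "finite S" "card S + 2 = d" "distinct [a, b, c, e]" "S \<inter> {a, b, c, e} = {}"
  defines "g \<equiv> gp_quot t {a, b, c} {e}"
  shows "R (insert b (insert c S)) * R (insert a (insert e S)) * g a
    + R (insert a (insert c S)) * R (insert b (insert e S)) * g b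
    + R (insert a (insert b S)) * R (insert c (insert e S)) * g c = 0"
proof -
  define p where "p = (\<lambda>xs. det (mat_of_cols d (map (\<lambda>i. col A (i - 1)) xs)))"
  have col: "range (\<lambda>i. col A (i - 1)) \<subseteq> carrier_vec d"
    using A by (auto simp: col_def)
  define s xs ys where "s = sorted_list_of_set S" and "xs = a # b # c # s" and "ys = e # s"
  have s: "distinct s" "set s = S" "length s = card S"
    using S(1) by (simp_all add: s_def)
  have l: "length xs = d + 1" "length ys + 1 = d" and dist: "distinct xs" "distinct ys"
    using S s by (auto simp: xs_def ys_def)
  have sets: "set xs = S \<union> {a, b, c}" "set ys = S \<union> {e}"
    using s by (auto simp: xs_def ys_def)
  define v where "v = vandermonde t xs * vandermonde t ys"
  have v: "v \<noteq> 0"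
    using dist vandermonde_eq_0_iff[OF assms(2)] by (simp add: v_def)
  define F where "F = (\<lambda>x. R (set xs - {x}) * R (insert x (set ys)) * gp_quot t (set xs) (set ys) x)"
  have "0 = (\<Sum>k<d + 1. (-1) ^ k * p (take k xs @ drop (Suc k) xs) * p (xs ! k # ys))"
    using det_grassmann_pluecker[OF col l] by (simp add: p_def)
  also have "\<dots> = (\<Sum>k<d + 1. v * F (xs ! k))"
  proof (intro sum.cong refl)
    fix k assume "k \<in> {..<d + 1}"
    then have k: "k < d + 1"
      by simp
    have "set (take k xs @ drop (Suc k) xs) = set xs - {xs ! k}"
      using dist(1) k l by (intro set_remove_nth) simp_all
    moreover have "length (take k xs @ drop (Suc k) xs) = d" "length (xs ! k # ys) = d"
      using k l by simp_all
    ultimately have "p (take k xs @ drop (Suc k) xs) = R (set xs - {xs ! k}) * vandermonde t (take k xs @ drop (Suc k) xs)"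
      "p (xs ! k # ys) = R (insert (xs ! k) (set ys)) * vandermonde t (xs ! k # ys)"
      using R[of "take k xs @ drop (Suc k) xs"] R[of "xs ! k # ys"] unfolding p_def by (simp_all only: list.set(2))
    then have "(-1) ^ k * p (take k xs @ drop (Suc k) xs) * p (xs ! k # ys)
      = R (set xs - {xs ! k}) * R (insert (xs ! k) (set ys))
        * ((-1) ^ k * vandermonde t (take k xs @ drop (Suc k) xs) * vandermonde t (xs ! k # ys))"
      by (simp only: mult_ac)
    also have "\<dots> = v * F (xs ! k)"
      using k l by (subst vandermonde_gp_term[OF assms(2) dist]) (simp_all add: v_def F_def mult_ac)
    finally show "(-1) ^ k * p (take k xs @ drop (Suc k) xs) * p (xs ! k # ys) = v * F (xs ! k)" .
  qed
  also have "\<dots> = v * (\<Sum>k<length xs. F (xs ! k))"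
    by (simp only: sum_distrib_left l)
  also have "(\<Sum>k<length xs. F (xs ! k)) = (\<Sum>x\<in>set xs. F x)"
    using dist(1) by (simp add: sum.distinct_set_conv_list sum_list_sum_nth atLeast0LessThan)
  \<comment> \<open>Summands at elements of \<open>S\<close> vanish, since these lie in both
    sets.\<close>
  also have "\<dots> = (\<Sum>x\<in>{a, b, c}. F x)"
    using S(1) by (intro sum.mono_neutral_right) (auto simp: sets F_def gp_quot_eq_0)
  also have "\<dots> = F a + F b + F c"
    using S(3) by simp
  finally have "F a + F b + F c = 0"
    using v by simp
  moreover have "gp_quot t (set xs) (set ys) x = g x" if "x \<in> {a, b, c}" for x
    unfolding sets g_def using S that by (intro gp_quot_cancel[OF assms(2)]) auto
  moreover have "set xs - {a} = insert b (insert c S)" "set xs - {b} = insert a (insert c S)"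
    "set xs - {c} = insert a (insert b S)"
    using S by (auto simp: sets)
  ultimately show ?thesis
    by (simp add: F_def sets)
qed

text \<open>Here \<open>R X\<close> is the quotient of the minors with column set \<open>X\<close> of a realization and of the
  Vandermonde matrix. It depends only on the set \<open>X\<close>, which removes all signs.\<close>

locale twisted_realization =
  fixes d m B \<omega> \<alpha> and R :: "nat set \<Rightarrow> complex"
  assumes d: "2 \<le> d" and \<omega>: "norm \<omega> = 1" and \<alpha>: "norm \<alpha> = 1"
    and relation: "\<And>S a b c e. \<lbrakk>finite S; card S + 2 = d; distinct [a, b, c, e]; S \<inter> {a, b, c, e} = {}\<rbrakk> \<Longrightarrow>
      R (insert b (insert c S)) * R (insert a (insert e S)) * gp_quot parabola {a, b, c} {e} a
      + R (insert a (insert c S)) * R (insert b (insert e S)) * gp_quot parabola {a, b, c} {e} b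
      + R (insert a (insert b S)) * R (insert c (insert e S)) * gp_quot parabola {a, b, c} {e} c = 0"
    and ph_R: "\<And>X. \<lbrakk>X \<subseteq> {1..m}; card X = d\<rbrakk> \<Longrightarrow> ph (R X) = \<alpha> * twist B \<omega> X"
begin

text \<open>Contracting \<open>S\<close> leaves rank 2, so \<open>S\<close> together with any two of
  \<open>a\<close>, \<open>b\<close>, \<open>c\<close>, \<open>e\<close> is a basis.\<close>

definition valid :: "nat set \<Rightarrow> nat \<Rightarrow> nat \<Rightarrow> nat \<Rightarrow> nat \<Rightarrow> bool" where
  "valid S a b c e \<longleftrightarrow> card S + 2 = d \<and> distinct [a, b, c, e] \<and> S \<inter> {a, b, c, e} = {}
     \<and> S \<union> {a, b, c, e} \<subseteq> {1..m}"

lemma finite_valid: "valid S a b c e \<Longrightarrow> finite S"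
  unfolding valid_def by (metis finite_atLeastAtMost finite_subset le_sup_iff)

lemma ph_R_insert:
  assumes "valid S a b c e" "x \<in> {a, b, c, e}" "y \<in> {a, b, c, e}" "x \<noteq> y"
  shows "ph (R (insert x (insert y S))) = \<alpha> * twist B \<omega> (insert x (insert y S))"
proof (rule ph_R)
  have "x \<notin> S" "y \<notin> S"
    using assms by (auto simp: valid_def)
  then show "card (insert x (insert y S)) = d"
    using assms finite_valid[OF assms(1)] by (simp add: valid_def)
qed (use assms in \<open>auto simp: valid_def\<close>)

lemma R_nonzero:
  assumes "valid S a b c e" "x \<in> {a, b, c, e}" "y \<in> {a, b, c, e}" "x \<noteq> y"
  shows "R (insert x (insert y S)) \<noteq> 0"
proof -
  have "norm (ph (R (insert x (insert y S)))) = 1"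
    using \<alpha> \<omega> by (simp add: ph_R_insert[OF assms] norm_mult twist_def)
  then show ?thesis
    by (auto simp: ph_def)
qed

text \<open>All bases in the relation lie between \<open>S\<close> and
  \<open>S \<union> {a, b, c, e}\<close>, so none is \<open>B\<close> and all products of ratios
  have phase \<open>\<alpha> * \<alpha>\<close>. By \<open>ph_eq_rigidity\<close> they are
  equal.\<close>

lemma R_untwisted:
  assumes v: "valid S a b c e" and B: "\<not> (S \<subseteq> B \<and> B \<subseteq> S \<union> {a, b, c, e})"
  shows "R (insert a (insert b S)) * R (insert c (insert e S))
       = R (insert a (insert c S)) * R (insert b (insert e S))"
proof -
  have d: "distinct [a, b, c, e]"
    using v by (simp add: valid_def)
  have ph: "ph (R (insert x (insert y S))) = \<alpha>"
    if "x \<in> {a, b, c, e}" "y \<in> {a, b, c, e}" "x \<noteq> y" for x y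
  proof -
    have "insert x (insert y S) \<noteq> B"
      using B that(1,2) by blast
    then show ?thesis
      using ph_R_insert[OF v that] by (simp add: twist_def)
  qed
  have rel: "R (insert b (insert c S)) * R (insert a (insert e S)) * gp_quot parabola {a, b, c} {e} a
      + R (insert a (insert c S)) * R (insert b (insert e S)) * gp_quot parabola {a, b, c} {e} b
      + R (insert a (insert b S)) * R (insert c (insert e S)) * gp_quot parabola {a, b, c} {e} c = 0"
    using v finite_valid[OF v] by (intro relation) (simp_all add: valid_def)
  have sum: "gp_quot parabola {a, b, c} {e} a + gp_quot parabola {a, b, c} {e} b
      + gp_quot parabola {a, b, c} {e} c = 0"
    using d by (intro gp_quot_sum inj_parabola) auto
  have "R (insert a (insert c S)) * R (insert b (insert e S)) \<noteq> 0"
    using d R_nonzero[OF v] by simp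
  moreover have "ph (R (insert b (insert c S)) * R (insert a (insert e S))) = \<alpha> * \<alpha>"
    "ph (R (insert a (insert c S)) * R (insert b (insert e S))) = \<alpha> * \<alpha>"
    "ph (R (insert a (insert b S)) * R (insert c (insert e S))) = \<alpha> * \<alpha>"
    using d by (simp_all add: ph_mult ph)
  ultimately show ?thesis
    using ph_eq_rigidity(2)[OF sum rel _ _ _ Im_gp_quot_parabola[OF d]] by simp
qed

text \<open>Subtracting \<open>?y\<close> times the relation of \<open>gp_quot_sum\<close> leaves
  only the term of \<open>c\<close>, whose coefficient must then vanish.\<close>

lemma R_third_product:
  assumes v: "valid S a b c e"
    and eq: "R (insert b (insert c S)) * R (insert a (insert e S))
       = R (insert a (insert c S)) * R (insert b (insert e S))" (is "?x = ?y")
  shows "R (insert a (insert b S)) * R (insert c (insert e S))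
       = R (insert a (insert c S)) * R (insert b (insert e S))" (is "?z = _")
proof -
  let ?g = "gp_quot parabola {a, b, c} {e}"
  have "?x * ?g a + ?y * ?g b + ?z * ?g c = 0"
    using v finite_valid[OF v] by (intro relation) (simp_all add: valid_def)
  moreover have g: "?g a + ?g b + ?g c = 0"
    using v by (intro gp_quot_sum inj_parabola) (auto simp: valid_def)
  ultimately have "?y * (?g a + ?g b) + ?z * ?g c = 0"
    by (simp only: eq distrib_left)
  also have "?g a + ?g b = - ?g c"
    using g by (simp add: eq_neg_iff_add_eq_0)
  finally have "(?z - ?y) * ?g c = 0"
    by (simp add: algebra_simps)
  moreover have "?g c \<noteq> 0"
    using v by (intro gp_quot_neq_0 inj_parabola) (auto simp: valid_def)
  ultimately show ?thesis
    by simp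
qed

text \<open>\<open>R_third_product\<close> equates two products of ratios. Exactly one of their four
  factors belongs to \<open>B\<close>, so the phases are
  \<open>\<alpha> * \<alpha> * \<omega>\<close> and \<open>\<alpha> * \<alpha>\<close>.\<close>

lemma twist_trivial:
  assumes v: "valid S a b c e"
    and eq: "R (insert b (insert c S)) * R (insert a (insert e S))
       = R (insert a (insert c S)) * R (insert b (insert e S))"
    and B: "B = insert a (insert b S) \<or> B = insert c (insert e S)"
  shows "\<omega> = 1"
proof -
  have d: "distinct [a, b, c, e]" "S \<inter> {a, b, c, e} = {}"
    using v by (simp_all add: valid_def)
  \<comment> \<open>\<open>B\<close> contains both or neither of \<open>a\<close> and
    \<open>b\<close>, while the bases on the right-hand side contain exactly one of them.\<close>
  have neq: "B \<noteq> insert a (insert c S)" "B \<noteq> insert b (insert e S)"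
    "insert a (insert b S) \<noteq> insert c (insert e S)"
  proof -
    have nin: "b \<notin> insert a (insert c S)" "a \<notin> insert b (insert e S)" "a \<notin> insert c (insert e S)"
      "b \<notin> insert c (insert e S)"
      using d by simp_all
    then have "a \<in> B \<longleftrightarrow> b \<in> B"
      using B by (elim disjE) simp_all
    with nin show "B \<noteq> insert a (insert c S)" "B \<noteq> insert b (insert e S)"
      by (metis insertI1)+
    show "insert a (insert b S) \<noteq> insert c (insert e S)"
      using nin(3) by (metis insertI1)
  qed
  moreover have "ph (R (insert a (insert b S))) * ph (R (insert c (insert e S)))
       = ph (R (insert a (insert c S))) * ph (R (insert b (insert e S)))"
    by (simp flip: ph_mult add: R_third_product[OF v eq])
  moreover have "ph (R (insert a (insert b S))) = \<alpha> * twist B \<omega> (insert a (insert b S))"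
    "ph (R (insert c (insert e S))) = \<alpha> * twist B \<omega> (insert c (insert e S))"
    using d by (intro ph_R_insert[OF v]; simp)+
  moreover have "ph (R (insert a (insert c S))) = \<alpha>" "ph (R (insert b (insert e S))) = \<alpha>"
    using d neq by (simp_all add: ph_R_insert[OF v] twist_def)
  moreover have "twist B \<omega> (insert a (insert b S)) * twist B \<omega> (insert c (insert e S)) = \<omega>"
    using B
  proof
    assume "B = insert a (insert b S)"
    then have "insert c (insert e S) \<noteq> B"
      using neq(3) by metis
    with \<open>B = _\<close> show ?thesis
      by (simp add: twist_def)
  next
    assume "B = insert c (insert e S)"
    then have "insert a (insert b S) \<noteq> B"
      using neq(3) by metis
    with \<open>B = _\<close> show ?thesis
      by (simp add: twist_def)
  qed
  ultimately have "\<alpha> * \<alpha> * \<omega> = \<alpha> * \<alpha>"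
    by (simp add: mult.assoc mult.left_commute)
  moreover have "\<alpha> \<noteq> 0"
    using \<alpha> by auto
  ultimately show ?thesis
    by simp
qed

text \<open>The cross ratios of \<open>x1, x3, x4, x5\<close> and \<open>x2, x3, x4, x5\<close>, which do not involve \<open>B\<close>, determine
  the cross ratio of \<open>x1, x2, x3, x4\<close>.\<close>

lemma twist_trivial_rank:
  assumes "card S + 2 = d" "distinct [x1, x2, x3, x4, x5]" "S \<inter> {x1, x2, x3, x4, x5} = {}"
    and "S \<union> {x1, x2, x3, x4, x5} \<subseteq> {1..m}" and B: "B = insert x1 (insert x2 S)"
  shows "\<omega> = 1"
proof -
  define r where "r = (\<lambda>x y. R (insert x (insert y S)))"
  have v: "valid S x1 x3 x4 x5" "valid S x2 x3 x4 x5" "valid S x1 x2 x3 x4"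
    using assms by (auto simp: valid_def)
  \<comment> \<open>The bases in this relation avoid \<open>x2\<close> and those in the next avoid
    \<open>x1\<close>, whereas \<open>B\<close> contains both.\<close>
  have 1: "r x1 x3 * r x4 x5 = r x1 x4 * r x3 x5"
    unfolding r_def using assms by (intro R_untwisted[OF v(1)]) auto
  have 2: "r x2 x3 * r x4 x5 = r x2 x4 * r x3 x5"
    unfolding r_def using assms by (intro R_untwisted[OF v(2)]) auto
  have nz: "r x4 x5 \<noteq> 0" "r x3 x5 \<noteq> 0"
    unfolding r_def using assms R_nonzero[OF v(1)] by auto
  \<comment> \<open>Multiply the two equations crosswise, then cancel
    \<open>r x4 x5 * r x3 x5\<close>.\<close>
  have "(r x2 x3 * r x1 x4) * (r x4 x5 * r x3 x5) = (r x2 x3 * r x4 x5) * (r x1 x4 * r x3 x5)"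
    by (simp only: mult_ac)
  also have "\<dots> = (r x2 x4 * r x3 x5) * (r x1 x3 * r x4 x5)"
    by (simp only: 1 2)
  also have "\<dots> = (r x1 x3 * r x2 x4) * (r x4 x5 * r x3 x5)"
    by (simp only: mult_ac)
  finally have "r x2 x3 * r x1 x4 = r x1 x3 * r x2 x4"
    using nz by simp
  then show ?thesis
    unfolding r_def by (rule twist_trivial[OF v(3)]) (simp add: B)
qed

text \<open>The dual argument: on \<open>x1, \<dots>, x5\<close>, rank 3 is dual to rank 2.\<close>

lemma twist_trivial_corank:
  assumes "card T + 3 = d" "distinct [x1, x2, x3, x4, x5]" "T \<inter> {x1, x2, x3, x4, x5} = {}"
    and "T \<union> {x1, x2, x3, x4, x5} \<subseteq> {1..m}" and B: "B = insert x3 (insert x4 (insert x5 T))"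
  shows "\<omega> = 1"
proof -
  define r where "r = (\<lambda>x y z. R (insert x (insert y (insert z T))))"
  have "finite T"
    using assms(4) finite_subset by auto
  then have v: "valid (insert x2 T) x1 x3 x4 x5" "valid (insert x1 T) x2 x3 x4 x5" "valid (insert x5 T) x1 x2 x3 x4"
    using assms by (auto simp: valid_def)
  \<comment> \<open>The bases in this relation contain \<open>x2\<close> and those in the next
    contain \<open>x1\<close>, whereas \<open>B\<close> contains neither.\<close>
  have 1: "r x1 x3 x2 * r x4 x5 x2 = r x1 x4 x2 * r x3 x5 x2"
    unfolding r_def using assms by (intro R_untwisted[OF v(1)]) auto
  have 2: "r x2 x3 x1 * r x4 x5 x1 = r x2 x4 x1 * r x3 x5 x1"
    unfolding r_def using assms by (intro R_untwisted[OF v(2)]) auto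
  have nz: "r x1 x3 x2 \<noteq> 0" "r x1 x4 x2 \<noteq> 0"
    unfolding r_def using assms R_nonzero[OF v(1)] by auto
  have s: "r x y z = r y x z" "r x y z = r x z y" for x y z
    by (simp_all add: r_def insert_commute)
  have e: "r x2 x3 x1 = r x1 x3 x2" "r x2 x4 x1 = r x1 x4 x2" "r x4 x5 x1 = r x1 x4 x5" "r x3 x5 x1 = r x1 x3 x5"
    "r x4 x5 x2 = r x2 x4 x5" "r x3 x5 x2 = r x2 x3 x5"
    by (metis s)+
  \<comment> \<open>Again a product of the two equations; here the factors that cancel are those
    containing both \<open>x1\<close> and \<open>x2\<close>.\<close>
  have "(r x2 x3 x5 * r x1 x4 x5) * (r x1 x3 x2 * r x1 x4 x2) = (r x1 x4 x2 * r x3 x5 x2) * (r x2 x3 x1 * r x4 x5 x1)"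
    by (simp only: e mult_ac)
  also have "\<dots> = (r x1 x3 x2 * r x4 x5 x2) * (r x2 x4 x1 * r x3 x5 x1)"
    by (simp only: 1 2)
  also have "\<dots> = (r x1 x3 x5 * r x2 x4 x5) * (r x1 x3 x2 * r x1 x4 x2)"
    by (simp only: e mult_ac)
  finally have "r x2 x3 x5 * r x1 x4 x5 = r x1 x3 x5 * r x2 x4 x5"
    using nz by simp
  then show ?thesis
    unfolding r_def by (rule twist_trivial[OF v(3)]) (simp add: B)
qed

end

section \<open>Realizations, real representatives and the conclusion\<close>

lemma realizable_imp_twisted_realization:
  assumes "2 \<le> d" "norm \<omega> = 1" "A \<in> carrier_mat d m" "norm \<alpha> = 1"
    and A: "\<And>xs. xs \<in> tuples d m \<Longrightarrow> phirotope_of_mat d m A xs = \<alpha> * twisted_phirotope d m B \<omega> xs"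
  obtains R where "twisted_realization d m B \<omega> \<alpha> R"
proof -
  obtain R where R: "\<And>xs. length xs = d \<Longrightarrow>
      det (mat_of_cols d (map (\<lambda>i. col A (i - 1)) xs)) = R (set xs) * vandermonde parabola xs"
    using realization_ratio[OF assms(3) inj_parabola] by blast
  have "twisted_realization d m B \<omega> \<alpha> R"
  proof
    fix X assume X: "X \<subseteq> {1..m}" "card X = d"
    define xs where "xs = sorted_list_of_set X"
    have "finite X"
      using X(1) finite_subset by blast
    with X have xs: "xs \<in> tuples d m" "set xs = X" "distinct xs" "length xs = d"
      by (auto simp: xs_def tuples_def)
    have "ph (R X) * ph (vandermonde parabola xs) = \<alpha> * twist B \<omega> X * ph (vandermonde parabola xs)"
      using A[OF xs(1)] R[OF xs(4)] xs(1,2)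
      by (simp add: phirotope_of_mat_def twisted_phirotope_def ph_mult)
    moreover have "ph (vandermonde parabola xs) \<noteq> 0"
      using xs(3) by (simp add: ph_eq_0_iff vandermonde_eq_0_iff inj_parabola)
    ultimately show "ph (R X) = \<alpha> * twist B \<omega> X"
      by simp
  qed (use assms in \<open>auto intro!: realization_ratio_relation[OF _ inj_parabola R]\<close>)
  then show thesis
    by (rule that)
qed

text \<open>Real values would make every summand real after scaling by
  \<open>\<alpha> * \<alpha>\<close>. Then \<open>\<tau> 2 * cnj (\<tau> 1)\<close> would be real,
  against \<open>gp_phase_nonreal\<close>.\<close>

lemma twisted_phirotope_not_chirotopal:
  assumes "2 \<le> d" "d + 2 \<le> m" and \<omega>: "norm \<omega> = 1" "small_rotation m \<omega>" and \<alpha>: "norm \<alpha> = 1"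
    and \<chi>: "\<And>xs. xs \<in> tuples d m \<Longrightarrow> \<alpha> * twisted_phirotope d m B \<omega> xs \<in> \<real>"
  shows False
proof -
  define \<phi> where "\<phi> = twisted_phirotope d m B \<omega>"
  \<comment> \<open>The \<open>d - 2\<close> elements from 5 to \<open>d + 2\<close> are contracted,
    which leaves 1, 2, 3 against 4.\<close>
  define xs ys where "xs = [1, 2, 3] @ [5..<d + 3]" and "ys = 4 # [5..<d + 3]"
  have xs: "xs \<in> tuples (d + 1) m" "distinct xs" and ys: "ys \<in> tuples (d - 1) m" "distinct ys"
    using assms(1,2) by (auto simp: xs_def ys_def tuples_def)
  obtain C where C: "C \<noteq> 0"
    "map (\<lambda>k. (-1) ^ k * \<phi> (take (k - 1) xs @ drop k xs) * \<phi> (xs ! (k - 1) # ys)) [1..<d + 2]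
     = map (gp_phase B \<omega> C (set xs) (set ys)) xs"
    using twisted_phirotope_gp_terms[OF assms(1) xs ys] unfolding \<phi>_def by blast
  define \<tau> where "\<tau> = gp_phase B \<omega> C (set xs) (set ys)"
  have "\<alpha> * \<alpha> * \<tau> x \<in> \<real>" if "x \<in> set xs" for x
  proof -
    have "\<tau> x \<in> set (map \<tau> xs)"
      using that by simp
    also have "\<dots> = (\<lambda>k. (-1) ^ k * \<phi> (take (k - 1) xs @ drop k xs) * \<phi> (xs ! (k - 1) # ys)) ` {1..<d + 2}"
      by (simp only: \<tau>_def C(2)[symmetric] set_map set_upt)
    finally obtain k where k: "k \<in> {1..<d + 2}"
      "\<tau> x = (-1) ^ k * \<phi> (take (k - 1) xs @ drop k xs) * \<phi> (xs ! (k - 1) # ys)"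
      by blast
    then have k1: "k - 1 < d + 1" "Suc (k - 1) = k"
      by auto
    then have t: "take (k - 1) xs @ drop k xs \<in> tuples d m"
      using tuples_remove(1)[OF xs, of "k - 1"] by simp
    have "length xs = d + 1"
      using xs by (simp add: tuples_def)
    then have "xs ! (k - 1) \<in> set xs"
      using k1 by (intro nth_mem) simp
    then have "xs ! (k - 1) # ys \<in> tuples d m"
      using xs(1) ys(1) assms(1) by (auto simp: tuples_def)
    with t have "(-1) ^ k * (\<alpha> * \<phi> (take (k - 1) xs @ drop k xs)) * (\<alpha> * \<phi> (xs ! (k - 1) # ys)) \<in> \<real>"
      unfolding \<phi>_def by (intro Reals_mult \<chi> Reals_power) auto
    then show ?thesis
      by (simp add: k(2) mult_ac)
  qed
  then have "\<alpha> * \<alpha> * \<tau> 2 \<in> \<real>" "\<alpha> * \<alpha> * \<tau> 1 \<in> \<real>"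
    by (simp_all add: xs_def)
  then have "(\<alpha> * \<alpha> * \<tau> 2) * cnj (\<alpha> * \<alpha> * \<tau> 1) \<in> \<real>"
    by (metis Reals_cnj_iff Reals_mult)
  also have "(\<alpha> * \<alpha> * \<tau> 2) * cnj (\<alpha> * \<alpha> * \<tau> 1) = (\<alpha> * cnj \<alpha>) * (\<alpha> * cnj \<alpha>) * (\<tau> 2 * cnj (\<tau> 1))"
    by simp
  also have "\<alpha> * cnj \<alpha> = 1"
    using \<alpha> by (simp add: complex_norm_square[symmetric])
  finally have "Im (\<tau> 2 * cnj (\<tau> 1)) = 0"
    by (simp only: mult_1_left complex_is_Real_iff)
  moreover have "set xs = {5..<d + 3} \<union> {1, 2, 3}" "set ys = {5..<d + 3} \<union> {4}"
    by (auto simp: xs_def ys_def)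
  ultimately show False
    using gp_phase_nonreal[OF \<omega> C(1), of 1 2 3 4 "{5..<d + 3}" B] assms(1,2) by (simp add: \<tau>_def)
qed

theorem theorem5p2:
  fixes m d :: nat
  assumes "m \<ge> 5" and "2 \<le> d" and "d \<le> m - 2"
  shows "\<exists>\<Phi> \<in> weak_phased_matroids d m (uniform_bases d m).
           \<not> realizable d m \<Phi> \<and> \<not> chirotopal d m \<Phi>"
proof -
  \<comment> \<open>If \<open>d + 3 \<le> m\<close>, the \<open>d - 2\<close> elements of
    \<open>{6..d + 3}\<close> are contracted, for \<open>twist_trivial_rank\<close>. Otherwise
    \<open>m = d + 2\<close>, and the \<open>d - 3\<close> elements of \<open>{6..d + 2}\<close>
    serve for \<open>twist_trivial_corank\<close>.\<close>
  define B :: "nat set" where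
    "B = (if d + 3 \<le> m then insert 1 (insert 2 {6..d + 3}) else insert 3 (insert 4 (insert 5 {6..d + 2})))"
  obtain \<omega> where \<omega>: "norm \<omega> = 1" "\<omega> \<noteq> 1" "small_rotation m \<omega>"
    by (rule exists_small_rotation_parabola)
  define \<phi> where "\<phi> = twisted_phirotope d m B \<omega>"
  define \<Phi> where "\<Phi> = phase_equiv d m (uniform_bases d m) `` {\<phi>}"
  have "\<phi> \<in> weak_GP_functions_over d m (uniform_bases d m)"
    unfolding \<phi>_def using assms \<omega> by (intro twisted_phirotope_weak_GP) auto
  then have "\<Phi> \<in> weak_phased_matroids d m (uniform_bases d m)"
    by (simp add: \<Phi>_def weak_phased_matroids_def quotientI)
  moreover have scale: "\<exists>a. norm a = 1 \<and> (\<forall>xs\<in>tuples d m. \<psi> xs = a * \<phi> xs)" if "\<psi> \<in> \<Phi>" for \<psi>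
    using that by (auto simp: \<Phi>_def phase_equiv_def)
  have "\<not> realizable d m \<Phi>"
  proof
    assume "realizable d m \<Phi>"
    then obtain A where A: "A \<in> carrier_mat d m" "phirotope_of_mat d m A \<in> \<Phi>"
      by (auto simp: realizable_def)
    then obtain \<alpha> where "norm \<alpha> = 1" "\<forall>xs\<in>tuples d m. phirotope_of_mat d m A xs = \<alpha> * \<phi> xs"
      using scale by blast
    with A(1) assms(2) \<omega>(1) obtain R where "twisted_realization d m B \<omega> \<alpha> R"
      unfolding \<phi>_def by (auto elim: realizable_imp_twisted_realization)
    then interpret twisted_realization d m B \<omega> \<alpha> R .
    have "\<omega> = 1"
    proof (cases "d + 3 \<le> m")
      case True
      with assms(2) show ?thesis
        by (intro twist_trivial_rank[of "{6..d + 3}" 1 2 3 4 5]) (auto simp: B_def)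
    next
      case False
      \<comment> \<open>Here \<open>m \<ge> 5\<close> enters: with \<open>m = d + 2\<close> it gives
        rank at least 3.\<close>
      with assms have "d \<ge> 3" "m = d + 2"
        by auto
      with False show ?thesis
        by (intro twist_trivial_corank[of "{6..d + 2}" 1 2 3 4 5]) (auto simp: B_def)
    qed
    with \<open>\<omega> \<noteq> 1\<close> show False
      by simp
  qed
  moreover have "\<not> chirotopal d m \<Phi>"
  proof
    assume "chirotopal d m \<Phi>"
    then obtain \<chi> where \<chi>: "\<chi> \<in> \<Phi>" "\<chi> ` tuples d m \<subseteq> {0, 1, -1}"
      by (auto simp: chirotopal_def)
    then obtain \<alpha> where \<alpha>: "norm \<alpha> = 1" "\<forall>xs\<in>tuples d m. \<chi> xs = \<alpha> * \<phi> xs"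
      using scale by blast
    have "\<alpha> * twisted_phirotope d m B \<omega> xs \<in> \<real>" if "xs \<in> tuples d m" for xs
    proof -
      have "\<chi> xs \<in> {0, 1, -1}"
        using \<chi>(2) that by blast
      then have "\<chi> xs \<in> \<real>"
        by auto
      then show ?thesis
        using \<alpha>(2) that by (simp add: \<phi>_def)
    qed
    then show False
      using assms by (intro twisted_phirotope_not_chirotopal[OF assms(2) _ \<omega>(1,3) \<alpha>(1)]) auto
  qed
  ultimately show ?thesis
    by blast
qed

end
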